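(* Let $\mu$ be a probability measure on $\Lambda$. For each $N\ge 2$ let $(\xi^{N,\mu}_t)_{t\ge0}$ be the Fleming-Viot process with $N$ particles such that $(\xi^{N,\mu}_0(i),\ i=1,\dots,N)$ are i.i.d. with law $\mu$, and let $\eta^{N,\mu}_t(x)=\sum_{i=1}^N\mathbf 1\{\xi^{N,\mu}_t(i)=x\}$. Then, for every $t>0$ and $x\in\Lambda$, $$\lim_{N\to\infty}\mathbb E\Bigl(\frac{\eta^{N,\mu}_t(x)}{N}-\varphi^{\mu}_t(x)\Bigr)^2=0 .$$
   Context: Let $\Lambda$ be a countable set, $0\notin\Lambda$, and let $(Z_t)_{t\ge 0}$ be a pure jump regular (non-explosive) continuous-time Markov process on $\Lambda\cup\{0\}$ with transition rates matrix $Q=(q(x,y))$ and transition probabilities $P_t(x,y)$, with $0$ absorbing: $q(0,x)=0$ for all $x\in\Lambda$. Standing assumptions: $\bar q:=\sup_{x\in\Lambda}\sum_{y\in(\Lambda\cup\{0\})\setminus\{x\}}q(x,y)<\infty$; $P_t(x,y)>0$ for all $x,y\in\Lambda$ and $t>0$; the absorption time at $0$ is almost surely finite for every initial state. For a probability measure $\mu$ on $\Lambda$, the law at time $t$ of the process started from $\mu$ and conditioned on non-absorption until time $t$ is $$\varphi^\mu_t(x)=\frac{\sum_{y\in\Lambda}\mu(y)P_t(y,x)}{1-\sum_{y\in\Lambda}\mu(y)P_t(y,0)},\qquad x\in\Lambda.$$ Fleming-Viot process with $N\ge 2$ particles: the continuous-time Markov process $\xi_t=(\xi_t(1),\dots,\xi_t(N))$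 on $\Lambda^{\{1,\dots,N\}}$ in which particles move independently with rates $Q$ until absorption, and a particle that is absorbed at $0$ instantaneously jumps to the position of one of the other $N-1$ particles chosen uniformly at random. Its generator is $$\mathcal L^N f(\xi)=\sum_{i=1}^N\ \sum_{y\in\Lambda\setminus\{\xi(i)\}}\Bigl[q(\xi(i),y)+q(\xi(i),0)\,\frac{\eta(\xi,y)}{N-1}\Bigr]\bigl(f(\xi^{i,y})-f(\xi)\bigr),$$ where $\xi^{i,y}(j)=y$ for $j=i$ and $\xi^{i,y}(j)=\xi(j)$ otherwise, and $\eta(\xi,y)=\sum_{i=1}^N\mathbf 1\{\xi(i)=y\}$. *)

theory Defs
  imports "HOL-Probability.Probability"
begin

section \<open>Continuous-time Markov chains on a countable set\<close>

definition transition_function :: "'s set \<Rightarrow> (real \<Rightarrow> 's \<Rightarrow> 's \<Rightarrow> real) \<Rightarrow> bool" where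
  "transition_function S P \<longleftrightarrow>
     (\<forall>t\<ge>0. \<forall>x\<in>S. \<forall>y\<in>S. 0 \<le> P t x y) \<and>
     (\<forall>t\<ge>0. \<forall>x\<in>S. (P t x has_sum 1) S) \<and>
     (\<forall>x\<in>S. \<forall>y\<in>S. P 0 x y = of_bool (x = y)) \<and>
     (\<forall>s\<ge>0. \<forall>t\<ge>0. \<forall>x\<in>S. \<forall>y\<in>S. ((\<lambda>w. P s x w * P t w y) has_sum P (s + t) x y) S)"

text \<open>The off-diagonal rates are the right derivatives at time 0 of the transition
  probabilities, and the rate of leaving a state is the sum of the off-diagonal rates of its row.
  The diagonal of \<open>q\<close> is never referred to, so it may carry any convention, in particular
  \<open>q x x = - (\<Sum>\<^sub>\<infinity>y\<in>S - {x}. q x y)\<close>.\<close>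

definition has_rates :: "'s set \<Rightarrow> (real \<Rightarrow> 's \<Rightarrow> 's \<Rightarrow> real) \<Rightarrow> ('s \<Rightarrow> 's \<Rightarrow> real) \<Rightarrow> bool" where
  "has_rates S P q \<longleftrightarrow>
     (\<forall>x\<in>S. \<forall>y\<in>S - {x}. ((\<lambda>t. P t x y / t) \<longlongrightarrow> q x y) (at_right 0)) \<and>
     (\<forall>x\<in>S. q x summable_on (S - {x})) \<and>
     (\<forall>x\<in>S. ((\<lambda>t. (1 - P t x x) / t) \<longlongrightarrow> (\<Sum>\<^sub>\<infinity>y\<in>S - {x}. q x y)) (at_right 0))"

definition has_generator ::
    "'s set \<Rightarrow> (real \<Rightarrow> 's \<Rightarrow> 's \<Rightarrow> real) \<Rightarrow> (('s \<Rightarrow> real) \<Rightarrow> 's \<Rightarrow> real) \<Rightarrow> bool" where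
  "has_generator S P L \<longleftrightarrow>
     (\<forall>f. bounded (f ` S) \<longrightarrow>
       (\<forall>x\<in>S. ((\<lambda>t. ((\<Sum>\<^sub>\<infinity>y\<in>S. P t x y * f y) - f x) / t) \<longlongrightarrow> L f x) (at_right 0)))"

text \<open>A right-continuous step function of time with finitely many jumps in every bounded
  time interval (in particular no explosion).\<close>

definition regular_jump_path :: "(real \<Rightarrow> 's) \<Rightarrow> bool" where
  "regular_jump_path w \<longleftrightarrow>
     (\<forall>t\<ge>0. \<forall>\<^sub>F s in at_right t. w s = w t) \<and>
     (\<forall>T. finite {t \<in> {0<..T}. \<not> (\<forall>\<^sub>F s in at_left t. w s = w t)})"

text \<open>The initial law is not prescribed here. Only times \<open>t \<ge> 0\<close> matter.\<close>

definition jump_markov_process ::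
    "'s set \<Rightarrow> (real \<Rightarrow> 's \<Rightarrow> 's \<Rightarrow> real) \<Rightarrow> 'w measure \<Rightarrow> (real \<Rightarrow> 'w \<Rightarrow> 's) \<Rightarrow> bool" where
  "jump_markov_process S P M X \<longleftrightarrow>
     prob_space M \<and>
     (\<forall>t\<ge>0. X t \<in> measurable M (count_space S)) \<and>
     (\<forall>n (\<tau> :: nat \<Rightarrow> real) x.
        0 \<le> \<tau> 0 \<and> (\<forall>k\<le>n. \<tau> k \<le> \<tau> (Suc k)) \<and> (\<forall>k\<le>Suc n. x k \<in> S) \<longrightarrow>
        measure M {\<omega> \<in> space M. \<forall>k\<le>Suc n. X (\<tau> k) \<omega> = x k} =
        measure M {\<omega> \<in> space M. \<forall>k\<le>n. X (\<tau> k) \<omega> = x k}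
          * P (\<tau> (Suc n) - \<tau> n) (x n) (x (Suc n))) \<and>
     (AE \<omega> in M. regular_jump_path (\<lambda>t. X t \<omega>))"

definition absorption_time :: "'s \<Rightarrow> (real \<Rightarrow> 'w \<Rightarrow> 's) \<Rightarrow> 'w \<Rightarrow> ereal" where
  "absorption_time z X \<omega> = Inf {ereal t | t. 0 \<le> t \<and> X t \<omega> = z}"

definition conditioned_law ::
    "'a set \<Rightarrow> 'a \<Rightarrow> (real \<Rightarrow> 'a \<Rightarrow> 'a \<Rightarrow> real) \<Rightarrow> 'a measure \<Rightarrow> real \<Rightarrow> 'a \<Rightarrow> real" where
  "conditioned_law \<Lambda> z P \<mu> t x =
     (\<Sum>\<^sub>\<infinity>y\<in>\<Lambda>. measure \<mu> {y} * P t y x) / (1 - (\<Sum>\<^sub>\<infinity>y\<in>\<Lambda>. measure \<mu> {y} * P t y z))"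

section \<open>The Fleming-Viot particle system\<close>

definition occupation :: "nat \<Rightarrow> (nat \<Rightarrow> 'a) \<Rightarrow> 'a \<Rightarrow> real" where
  "occupation N \<xi> y = (\<Sum>i=1..N. of_bool (\<xi> i = y))"

definition fv_generator ::
    "'a set \<Rightarrow> 'a \<Rightarrow> ('a \<Rightarrow> 'a \<Rightarrow> real) \<Rightarrow> nat
      \<Rightarrow> ((nat \<Rightarrow> 'a) \<Rightarrow> real) \<Rightarrow> (nat \<Rightarrow> 'a) \<Rightarrow> real" where
  "fv_generator \<Lambda> z q N f \<xi> =
     (\<Sum>i=1..N. \<Sum>\<^sub>\<infinity>y\<in>\<Lambda> - {\<xi> i}.
        (q (\<xi> i) y + q (\<xi> i) z * (occupation N \<xi> y / (real N - 1))) * (f (\<xi>(i := y)) - f \<xi>))"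

definition fleming_viot ::
    "'a set \<Rightarrow> 'a \<Rightarrow> ('a \<Rightarrow> 'a \<Rightarrow> real) \<Rightarrow> nat
      \<Rightarrow> 'w measure \<Rightarrow> (real \<Rightarrow> 'w \<Rightarrow> nat \<Rightarrow> 'a) \<Rightarrow> bool" where
  "fleming_viot \<Lambda> z q N M \<xi> \<longleftrightarrow>
     (\<exists>R. transition_function ({1..N} \<rightarrow>\<^sub>E \<Lambda>) R \<and>
          has_generator ({1..N} \<rightarrow>\<^sub>E \<Lambda>) R (fv_generator \<Lambda> z q N) \<and>
          jump_markov_process ({1..N} \<rightarrow>\<^sub>E \<Lambda>) R M \<xi>)"

end

theory Submission
  imports Defs
begin

text \<open>Write \<open>m(f)\<close> for the average of \<open>f\<close> over the \<open>N\<close> particles and \<open>\<phi>\<^sub>s(f)\<close> for the mean of \<open>f\<close> under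
the conditioned law at time \<open>s\<close>. Let \<open>A\<close> be the generator of the chain, acting on functions that
vanish at the absorbing state \<open>z\<close>, and let \<open>k(x) = q(x, z)\<close> be the killing rate. Both \<open>\<phi>\<close> and the
drift of the particle system are governed by the same quadratic expression:
\<open>d/ds \<phi>\<^sub>s(f) = \<phi>\<^sub>s(A f) + \<phi>\<^sub>s(k) \<phi>\<^sub>s(f)\<close> because conditioning renormalises the lost mass, and
\<open>L\<^sup>N m(f) = m(A f) + m(k) m(f) + O(1/N)\<close> because a killed particle is put on a uniformly chosen other
one. Moreover a single jump changes \<open>m(f)\<close> by \<open>O(1/N)\<close> while the total jump rate is \<open>O(N)\<close>, so the
quadratic variation of \<open>m(f)\<close> has rate \<open>O(1/N)\<close>.

Hence, with \<open>D\<^sub>s(f) = m(f) - \<phi>\<^sub>s(f)\<close>, the derivative of \<open>E D\<^sub>s(f)\<^sup>2\<close> is, up to \<open>O(1/N)\<close>, twice the mean of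
\<open>D\<^sub>s(f) (D\<^sub>s(A f) + m(k) D\<^sub>s(f) + \<phi>\<^sub>s(f) D\<^sub>s(k))\<close>. The rates are bounded by \<open>c\<close>, so \<open>A f\<close> and \<open>k\<close> are multiples
of test functions whenever \<open>f\<close> is one, and the supremum \<open>U(s)\<close> of \<open>E D\<^sub>s(f)\<^sup>2\<close> over all test functions
satisfies \<open>U' \<le> 8 c U + O(1/N)\<close>. The initial value \<open>U(0) \<le> 4/N\<close> is the variance of an empirical mean of
independent variables, and Gronwall's inequality gives \<open>U(t) = O(1/N)\<close> for every fixed \<open>t\<close>.

The Gronwall argument is carried out in discrete time. What makes this possible is that a
Markov semigroup with bounded rates satisfies \<open>P\<^sub>h f = f + h L f + O(h\<^sup>2)\<close> with an explicit error that is
uniform in the state (\<open>second_order\<close>). Applied to the chain it gives \<open>cond_mean_step\<close>, applied to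
the particle system it gives \<open>deviation_step\<close>, the inequality for one time step of length \<open>h\<close>.
Iterating it \<open>n\<close> times with \<open>h = t / n\<close> and letting \<open>n\<close> tend to infinity yields
\<open>mean_square_deviation_le\<close>.\<close>

section \<open>Expectations under probability mass functions\<close>

abbreviation mean :: "'s pmf \<Rightarrow> ('s \<Rightarrow> real) \<Rightarrow> real" where
  "mean p f \<equiv> measure_pmf.expectation p f"

lemma integrable_pmf_bounded:
  fixes f :: "'s \<Rightarrow> real"
  assumes "\<And>x. x \<in> set_pmf p \<Longrightarrow> \<bar>f x\<bar> \<le> B"
  shows "integrable (measure_pmf p) f"
  by (rule measure_pmf.integrable_const_bound[where B = B]) (use assms in \<open>auto simp: AE_measure_pmf_iff\<close>)

lemma mean_mono:
  assumes "\<And>x. x \<in> set_pmf p \<Longrightarrow> \<bar>f x\<bar> \<le> B" "\<And>x. x \<in> set_pmf p \<Longrightarrow> \<bar>g x\<bar> \<le> B'"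
    and "\<And>x. x \<in> set_pmf p \<Longrightarrow> f x \<le> g x"
  shows "mean p f \<le> mean p g"
  using assms(3)
  by (intro integral_mono_AE integrable_pmf_bounded[OF assms(1)] integrable_pmf_bounded[OF assms(2)])
     (auto simp: AE_measure_pmf_iff)

lemma mean_abs_le:
  assumes "\<And>x. x \<in> set_pmf p \<Longrightarrow> \<bar>f x\<bar> \<le> B"
  shows "\<bar>mean p f\<bar> \<le> B"
proof -
  have "0 \<le> B"
    using assms set_pmf_not_empty[of p] by fastforce
  then have "mean p f \<le> mean p (\<lambda>_. B)" "mean p (\<lambda>_. - B) \<le> mean p f"
    using assms by (intro mean_mono[where B = B and B' = B]; fastforce)+
  then show ?thesis by simp
qed

lemma mean_diff:
  assumes "\<And>x. \<bar>f x\<bar> \<le> B" "\<And>x. \<bar>g x\<bar> \<le> B'"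
  shows "mean p (\<lambda>x. f x - g x) = mean p f - mean p g"
  by (intro Bochner_Integration.integral_diff integrable_pmf_bounded) (rule assms)+

lemma mean_add:
  assumes "\<And>x. \<bar>f x\<bar> \<le> B" "\<And>x. \<bar>g x\<bar> \<le> B'"
  shows "mean p (\<lambda>x. f x + g x) = mean p f + mean p g"
  by (intro Bochner_Integration.integral_add integrable_pmf_bounded) (rule assms)+

lemma mean_eq_infsum:
  assumes "set_pmf p \<subseteq> S" "\<And>x. x \<in> set_pmf p \<Longrightarrow> \<bar>f x\<bar> \<le> B"
  shows "mean p f = (\<Sum>\<^sub>\<infinity>x\<in>S. pmf p x * f x)"
proof -
  have int: "integrable (count_space UNIV) (\<lambda>x. pmf p x * f x)"
    using integrable_pmf_bounded[of p f B] assms(2)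
    by (auto simp: measure_pmf_eq_density integrable_density)
  have "mean p f = (\<integral>x. pmf p x * f x \<partial>count_space UNIV)"
    by (subst measure_pmf_eq_density, subst integral_density) auto
  also have "\<dots> = infsetsum (\<lambda>x. pmf p x * f x) UNIV"
    by (simp add: infsetsum_def)
  also have "\<dots> = (\<Sum>\<^sub>\<infinity>x. pmf p x * f x)"
    by (rule infsetsum_infsum) (use int in \<open>simp add: abs_summable_on_def\<close>)
  also have "\<dots> = (\<Sum>\<^sub>\<infinity>x\<in>S. pmf p x * f x)"
    by (rule infsum_cong_neutral) (use assms(1) in \<open>auto simp: set_pmf_iff\<close>)
  finally show ?thesis .
qed

lemma mean_bind:
  assumes "\<And>x. \<bar>f x\<bar> \<le> B"
  shows "mean (bind_pmf p k) f = mean p (\<lambda>x. mean (k x) f)"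
  unfolding measure_pmf_bind
  by (rule integral_bind[where K = "count_space UNIV" and B = B and B' = 1])
     (use assms in \<open>auto simp: measure_pmf.emeasure_space_le_1 AE_measure_pmf_iff subprob_space.subprob_emeasure_le_1
        measure_pmf_in_subprob_algebra\<close>)

lemma mean_of_bool_eq: "mean p (\<lambda>y. of_bool (y = x)) = pmf p x"
proof -
  have "mean p (\<lambda>y. of_bool (y = x)) = mean p (indicator {x})"
    by (rule arg_cong[where f = "mean p"]) (auto simp: indicator_def)
  then show ?thesis by (simp add: pmf.rep_eq)
qed

lemma mean_of_bool_neq: "mean p (\<lambda>y. of_bool (y \<noteq> x)) = 1 - pmf p x"
proof -
  have "mean p (\<lambda>y. of_bool (y \<noteq> x)) = mean p (\<lambda>y. 1 - of_bool (y = x))"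
    by (rule arg_cong[where f = "mean p"]) auto
  also have "\<dots> = mean p (\<lambda>_. 1) - mean p (\<lambda>y. of_bool (y = x))"
    by (rule mean_diff[where B = 1 and B' = 1]) auto
  finally show ?thesis by (simp add: mean_of_bool_eq)
qed

section \<open>Transition functions as probability kernels\<close>

text \<open>Outside \<open>S\<close> the kernel stays put. It is then a probability kernel on the whole type, and the
semigroup law and the identity at time 0 hold without membership conditions.\<close>

definition kernel :: "'s set \<Rightarrow> (real \<Rightarrow> 's \<Rightarrow> 's \<Rightarrow> real) \<Rightarrow> real \<Rightarrow> 's \<Rightarrow> 's pmf" where
  "kernel S P t x =
     (if x \<in> S then embed_pmf (\<lambda>y. if y \<in> S then P t x y else 0) else return_pmf x)"

lemma nn_integral_count_space_of_has_sum:
  fixes f :: "'s \<Rightarrow> real"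
  assumes "(f has_sum s) S" "\<And>y. y \<in> S \<Longrightarrow> 0 \<le> f y"
  shows "(\<integral>\<^sup>+y. ennreal (if y \<in> S then f y else 0) \<partial>count_space UNIV) = ennreal s"
proof -
  have abs: "Infinite_Set_Sum.abs_summable_on f S"
    unfolding abs_summable_equivalent[symmetric] using assms
    by (intro summable_on_iff_abs_summable_on_real[THEN iffD1]) (auto simp: summable_on_def)
  have "(\<integral>\<^sup>+y. ennreal (if y \<in> S then f y else 0) \<partial>count_space UNIV) = (\<integral>\<^sup>+y. ennreal (f y) \<partial>count_space S)"
    by (subst nn_integral_count_space_indicator) (auto intro!: nn_integral_cong simp: indicator_def)
  also have "\<dots> = ennreal (infsetsum f S)"
    unfolding infsetsum_def
    by (rule nn_integral_eq_integral)
       (use abs assms(2) in \<open>auto simp: AE_count_space abs_summable_on_def\<close>)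
  also have "infsetsum f S = s"
    using abs assms(1) by (simp add: infsetsum_infsum infsumI)
  finally show ?thesis .
qed

lemma pmf_kernel:
  assumes "transition_function S P" "0 \<le> t" "x \<in> S"
  shows "pmf (kernel S P t x) y = (if y \<in> S then P t x y else 0)"
proof -
  have "(\<integral>\<^sup>+y. ennreal (if y \<in> S then P t x y else 0) \<partial>count_space UNIV) = 1"
    using nn_integral_count_space_of_has_sum[where f = "P t x" and S = S and s = 1] assms
    by (auto simp: transition_function_def)
  then have "pmf (embed_pmf (\<lambda>y. if y \<in> S then P t x y else 0)) y = (if y \<in> S then P t x y else 0)"
    using assms by (intro pmf_embed_pmf) (auto simp: transition_function_def)
  then show ?thesis
    using assms(3) by (simp add: kernel_def)
qed

lemma set_kernel:
  assumes "transition_function S P" "0 \<le> t" "x \<in> S"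
  shows "set_pmf (kernel S P t x) \<subseteq> S"
  using pmf_kernel[OF assms] by (auto simp: set_pmf_iff split: if_splits)

lemma kernel_0:
  assumes "transition_function S P"
  shows "kernel S P 0 x = return_pmf x"
proof (cases "x \<in> S")
  case True
  show ?thesis
  proof (rule pmf_eqI)
    fix y show "pmf (kernel S P 0 x) y = pmf (return_pmf x) y"
      using assms True
      by (auto simp: pmf_kernel transition_function_def indicator_def)
  qed
qed (simp add: kernel_def)

lemma kernel_add:
  assumes P: "transition_function S P" and "0 \<le> s" "0 \<le> t"
  shows "kernel S P (s + t) x = bind_pmf (kernel S P s x) (kernel S P t)"
proof (cases "x \<in> S")
  case True
  show ?thesis
  proof (rule pmf_eqI)
    fix y
    have "pmf (bind_pmf (kernel S P s x) (kernel S P t)) y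
        = mean (kernel S P s x) (\<lambda>w. pmf (kernel S P t w) y)"
      by (simp add: pmf_bind)
    also have "\<dots> = (\<Sum>\<^sub>\<infinity>w\<in>S. pmf (kernel S P s x) w * pmf (kernel S P t w) y)"
      by (rule mean_eq_infsum[where B = 1])
         (use set_kernel[OF P _ True] assms in \<open>auto simp: pmf_le_1\<close>)
    also have "\<dots> = (\<Sum>\<^sub>\<infinity>w\<in>S. if y \<in> S then P s x w * P t w y else 0)"
      by (rule infsum_cong) (use assms True in \<open>simp add: pmf_kernel\<close>)
    also have "\<dots> = (if y \<in> S then P (s + t) x y else 0)"
      using assms True by (auto simp: transition_function_def intro!: infsumI)
    finally show "pmf (kernel S P (s + t) x) y = pmf (bind_pmf (kernel S P s x) (kernel S P t)) y"
      using assms True by (simp add: pmf_kernel)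
  qed
qed (simp add: kernel_def bind_return_pmf)

section \<open>Semigroups with bounded rates\<close>

locale bounded_rate_semigroup =
  fixes K :: "real \<Rightarrow> 's \<Rightarrow> 's pmf" and c :: real
  assumes K_0: "K 0 x = return_pmf x"
    and K_add: "0 \<le> s \<Longrightarrow> 0 \<le> t \<Longrightarrow> K (s + t) x = bind_pmf (K s x) (K t)"
    and leaving_rate: "\<exists>r\<le>c. ((\<lambda>t. (1 - pmf (K t x) x) / t) \<longlongrightarrow> r) (at_right 0)"
begin

lemma filterlim_step: "0 < t \<Longrightarrow> filterlim (\<lambda>n. t / real (Suc n)) (at_right 0) sequentially"
  by real_asymp

text \<open>The probability of being in \<open>x\<close> at time \<open>t\<close> is at least that of being in \<open>x\<close> at all the times
\<open>t / n, 2 t / n, \<dots>, t\<close>, that is, at least \<open>p (t / n)\<^sup>n\<close> where \<open>p s\<close> is the probability of return to \<open>x\<close>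
at time \<open>s\<close>. By Bernoulli's inequality this is at least \<open>1 - n (1 - p (t / n))\<close>, which tends to
\<open>1 - r t\<close>. So the rate at time 0 alone controls all times.\<close>

lemma leaving_probability:
  assumes "0 \<le> t" and r: "((\<lambda>t. (1 - pmf (K t x) x) / t) \<longlongrightarrow> r) (at_right 0)"
  shows "1 - pmf (K t x) x \<le> r * t"
proof (cases "t = 0")
  case False
  then have t: "0 < t" using assms by simp
  have two: "pmf (K s x) x * pmf (K u x) x \<le> pmf (K (s + u) x) x" if "0 \<le> s" "0 \<le> u" for s u
  proof -
    have "pmf (K s x) x * pmf (K u x) x = mean (K s x) (\<lambda>y. of_bool (y = x) * pmf (K u x) x)"
      by (simp add: mean_of_bool_eq)
    also have "\<dots> \<le> mean (K s x) (\<lambda>y. pmf (K u y) x)"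
      by (rule mean_mono[where B = 1 and B' = 1]) (auto simp: pmf_le_1)
    also have "\<dots> = pmf (K (s + u) x) x"
      using that by (simp add: K_add pmf_bind)
    finally show ?thesis .
  qed
  have pow: "pmf (K s x) x ^ n \<le> pmf (K (real n * s) x) x" if "0 \<le> s" for s n
  proof (induction n)
    case 0 show ?case by (simp add: K_0)
  next
    case (Suc n)
    have "pmf (K s x) x ^ Suc n \<le> pmf (K s x) x * pmf (K (real n * s) x) x"
      using Suc by (simp add: mult_left_mono)
    also have "\<dots> \<le> pmf (K (s + real n * s) x) x"
      using that by (intro two) auto
    finally show ?case by (simp add: algebra_simps)
  qed
  have "1 - pmf (K t x) x \<le> t * ((1 - pmf (K (t / real (Suc n)) x) x) / (t / real (Suc n)))" for n
  proof -
    define s where "s = t / real (Suc n)"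
    have s: "0 \<le> s" "real (Suc n) * s = t" using t by (auto simp: s_def)
    have "1 + real (Suc n) * (pmf (K s x) x - 1) \<le> (1 + (pmf (K s x) x - 1)) ^ Suc n"
      by (rule Bernoulli_inequality) simp
    also have "\<dots> \<le> pmf (K t x) x"
      using pow[OF s(1), of "Suc n"] s(2) by simp
    finally have "1 - pmf (K t x) x \<le> real (Suc n) * (1 - pmf (K s x) x)"
      by (simp add: algebra_simps)
    also have "\<dots> = t * ((1 - pmf (K s x) x) / s)"
      using t by (simp add: s_def field_simps)
    finally show ?thesis by (simp only: s_def)
  qed
  moreover have "(\<lambda>n. t * ((1 - pmf (K (t / real (Suc n)) x) x) / (t / real (Suc n)))) \<longlonglongrightarrow> t * r"
    by (intro tendsto_mult_left filterlim_compose[OF r filterlim_step] t)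
  ultimately have "1 - pmf (K t x) x \<le> t * r"
    by (rule_tac LIMSEQ_le_const) auto
  then show ?thesis by (simp add: mult.commute)
qed (simp add: K_0)

lemma leaving_probability_le:
  assumes "0 \<le> t"
  shows "1 - pmf (K t x) x \<le> c * t"
proof -
  obtain r where "r \<le> c" "((\<lambda>t. (1 - pmf (K t x) x) / t) \<longlongrightarrow> r) (at_right 0)"
    using leaving_rate by blast
  then show ?thesis
    using leaving_probability[of t x r] mult_right_mono[of r c t] assms by linarith
qed

lemma rate_nonneg: "0 \<le> c"
  using leaving_probability_le[of 1 undefined] pmf_le_1[of "K 1 undefined" undefined] by linarith

lemma first_order:
  assumes "0 \<le> h" "\<And>y. \<bar>f y\<bar> \<le> B"
  shows "\<bar>mean (K h x) f - f x\<bar> \<le> 2 * c * h * B"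
proof -
  have B: "0 \<le> B" using assms(2)[of x] by linarith
  have "mean (K h x) f - f x = mean (K h x) (\<lambda>y. f y - f x)"
    by (subst mean_diff[where B = B and B' = B]) (use assms in auto)
  also have "\<bar>\<dots>\<bar> \<le> mean (K h x) (\<lambda>y. \<bar>f y - f x\<bar>)"
    by simp
  also have "\<dots> \<le> mean (K h x) (\<lambda>y. 2 * B * of_bool (y \<noteq> x))"
  proof (rule mean_mono[where B = "2 * B" and B' = "2 * B"])
    fix y
    have "\<bar>f y - f x\<bar> \<le> 2 * B" using assms(2)[of y] assms(2)[of x] by linarith
    then show "\<bar>\<bar>f y - f x\<bar>\<bar> \<le> 2 * B" "\<bar>f y - f x\<bar> \<le> 2 * B * of_bool (y \<noteq> x)" by auto
  qed (use B in auto)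
  also have "\<dots> = 2 * B * (1 - pmf (K h x) x)"
    by (simp add: mean_of_bool_neq)
  also have "\<dots> \<le> 2 * B * (c * h)"
    using B by (intro mult_left_mono leaving_probability_le assms) auto
  finally show ?thesis by (simp add: mult_ac)
qed

text \<open>With \<open>s = h / n\<close> and \<open>g = P\<^sub>s f - f\<close>, the increment \<open>P\<^sub>h f - f\<close> telescopes into the sum of \<open>P\<^sub>j\<^sub>s g\<close> over
\<open>j < n\<close>. The bound of first order gives \<open>g = O(s)\<close> and \<open>P\<^sub>j\<^sub>s g - g = O(h s)\<close>, so
\<open>P\<^sub>h f - f = n g + O(h\<^sup>2)\<close>. As \<open>n\<close> tends to infinity, \<open>n g x\<close> tends to \<open>h d\<close>. A limit at the single
point \<open>x\<close> is thus enough, while the error is uniform in \<open>x\<close>.\<close>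

lemma second_order:
  assumes h: "0 \<le> h" and f: "\<And>y. \<bar>f y\<bar> \<le> B"
    and lim: "((\<lambda>t. (mean (K t x) f - f x) / t) \<longlongrightarrow> d) (at_right 0)"
  shows "\<bar>mean (K h x) f - f x - h * d\<bar> \<le> 4 * c\<^sup>2 * h\<^sup>2 * B"
proof (cases "h = 0")
  case False
  then have h: "0 < h" using h by simp
  have step: "\<bar>mean (K h x) f - f x - h * ((mean (K (h / real (Suc n)) x) f - f x) / (h / real (Suc n)))\<bar>
      \<le> 4 * c\<^sup>2 * h\<^sup>2 * B" for n
  proof -
    define s where "s = h / real (Suc n)"
    have s: "0 \<le> s" "real (Suc n) * s = h" using h by (auto simp: s_def)
    define g where "g y = mean (K s y) f - f y" for y
    have g: "\<bar>g y\<bar> \<le> 2 * c * s * B" for y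
      unfolding g_def by (rule first_order[OF s(1) f])
    have Kf: "\<bar>mean (K u y) f\<bar> \<le> B" for u y
      by (rule mean_abs_le) (rule f)
    have tele: "mean (K (real k * s) x) f - f x = (\<Sum>j<k. mean (K (real j * s) x) g)" for k
    proof (induction k)
      case 0 show ?case by (simp add: K_0)
    next
      case (Suc k)
      have "mean (K (real (Suc k) * s) x) f = mean (K (real k * s + s) x) f"
        by (simp add: algebra_simps)
      also have "\<dots> = mean (K (real k * s) x) (\<lambda>y. mean (K s y) f)"
        using s(1) by (simp add: K_add mean_bind[OF f])
      also have "\<dots> = mean (K (real k * s) x) f + mean (K (real k * s) x) g"
        unfolding g_def by (subst mean_diff[where B = B and B' = B]) (use f Kf in auto)
      finally show ?case using Suc by simp
    qed
    have "mean (K h x) f - f x - real (Suc n) * g x = (\<Sum>j<Suc n. mean (K (real j * s) x) g - g x)"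
      using tele[of "Suc n"] s(2) by (simp add: sum_subtractf algebra_simps)
    also have "\<bar>\<dots>\<bar> \<le> (\<Sum>j<Suc n. 2 * c * h * (2 * c * s * B))"
    proof (rule order_trans[OF sum_abs sum_mono])
      fix j assume "j \<in> {..<Suc n}"
      then have "real j * s \<le> real (Suc n) * s"
        using s(1) by (intro mult_right_mono) auto
      then have "real j * s \<le> h" using s(2) by simp
      have B: "0 \<le> 2 * c * s * B" using g[of x] by linarith
      have "\<bar>mean (K (real j * s) x) g - g x\<bar> \<le> 2 * c * (real j * s) * (2 * c * s * B)"
        by (rule first_order) (use s(1) g in auto)
      also have "\<dots> \<le> 2 * c * h * (2 * c * s * B)"
        using \<open>real j * s \<le> h\<close> rate_nonneg B by (intro mult_right_mono mult_left_mono) auto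
      finally show "\<bar>mean (K (real j * s) x) g - g x\<bar> \<le> 2 * c * h * (2 * c * s * B)" .
    qed
    also have "\<dots> = 4 * c\<^sup>2 * h * B * (real (Suc n) * s)"
      by (simp add: power2_eq_square algebra_simps)
    also have "\<dots> = 4 * c\<^sup>2 * h\<^sup>2 * B"
      unfolding s(2) by (simp add: power2_eq_square)
    also have "real (Suc n) * g x = h * ((mean (K s x) f - f x) / s)"
      using h by (simp add: s_def g_def field_simps)
    finally show ?thesis by (simp only: s_def)
  qed
  have "(\<lambda>n. \<bar>mean (K h x) f - f x - h * ((mean (K (h / real (Suc n)) x) f - f x) / (h / real (Suc n)))\<bar>)
      \<longlonglongrightarrow> \<bar>mean (K h x) f - f x - h * d\<bar>"
    by (intro tendsto_intros filterlim_compose[OF lim filterlim_step] h)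
  then show ?thesis
    by (rule LIMSEQ_le_const2) (use step in auto)
qed (simp add: K_0)

end

section \<open>The generator of a chain with given rates\<close>

lemma infsum_mult_bounded:
  fixes w f :: "'a \<Rightarrow> real"
  assumes w: "w summable_on A" "\<And>y. y \<in> A \<Longrightarrow> 0 \<le> w y" and f: "\<And>y. y \<in> A \<Longrightarrow> \<bar>f y\<bar> \<le> B"
  shows "(\<lambda>y. w y * f y) summable_on A" "\<bar>\<Sum>\<^sub>\<infinity>y\<in>A. w y * f y\<bar> \<le> B * (\<Sum>\<^sub>\<infinity>y\<in>A. w y)"
proof -
  have le: "norm (w y * f y) \<le> B * w y" if "y \<in> A" for y
    using mult_left_mono[OF f[OF that] w(2)[OF that]] w(2)[OF that] by (simp add: abs_mult mult.commute)
  have B: "(\<lambda>y. B * w y) summable_on A"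
    using w(1) by (rule summable_on_cmult_right)
  have abs: "Infinite_Sum.abs_summable_on (\<lambda>y. w y * f y) A"
    by (rule Infinite_Sum.abs_summable_on_comparison_test'[OF B le])
  then show "(\<lambda>y. w y * f y) summable_on A"
    by (rule abs_summable_summable)
  have "\<bar>\<Sum>\<^sub>\<infinity>y\<in>A. w y * f y\<bar> \<le> (\<Sum>\<^sub>\<infinity>y\<in>A. norm (w y * f y))"
    using norm_infsum_bound[OF abs] by simp
  also have "\<dots> \<le> (\<Sum>\<^sub>\<infinity>y\<in>A. B * w y)"
    using abs B le by (rule infsum_mono)
  finally show "\<bar>\<Sum>\<^sub>\<infinity>y\<in>A. w y * f y\<bar> \<le> B * (\<Sum>\<^sub>\<infinity>y\<in>A. w y)"
    by (simp add: infsum_cmult_right')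
qed

lemma infsum_split_finite:
  fixes w :: "'a \<Rightarrow> real"
  assumes "w summable_on A" "finite G" "G \<subseteq> A"
  shows "(\<Sum>\<^sub>\<infinity>y\<in>A. w y) = sum w G + (\<Sum>\<^sub>\<infinity>y\<in>A - G. w y)"
proof -
  have "(\<Sum>\<^sub>\<infinity>y\<in>G \<union> (A - G). w y) = (\<Sum>\<^sub>\<infinity>y\<in>G. w y) + (\<Sum>\<^sub>\<infinity>y\<in>A - G. w y)"
    using assms by (intro infsum_Un_disjoint) (auto intro: summable_on_subset_banach)
  then show ?thesis
    using assms by (simp add: Un_absorb1)
qed

lemma infsum_mult_truncation:
  fixes w f :: "'a \<Rightarrow> real"
  assumes w: "w summable_on A" "\<And>y. y \<in> A \<Longrightarrow> 0 \<le> w y" and f: "\<And>y. y \<in> A \<Longrightarrow> \<bar>f y\<bar> \<le> B"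
    and G: "finite G" "G \<subseteq> A"
  shows "\<bar>(\<Sum>\<^sub>\<infinity>y\<in>A. w y * f y) - (\<Sum>y\<in>G. w y * f y)\<bar> \<le> B * ((\<Sum>\<^sub>\<infinity>y\<in>A. w y) - (\<Sum>y\<in>G. w y))"
proof -
  have "w summable_on (A - G)"
    using w(1) by (rule summable_on_subset_banach) auto
  then have "\<bar>\<Sum>\<^sub>\<infinity>y\<in>A - G. w y * f y\<bar> \<le> B * (\<Sum>\<^sub>\<infinity>y\<in>A - G. w y)"
    using w f by (intro infsum_mult_bounded) auto
  then show ?thesis
    using infsum_split_finite[OF w(1) G] infsum_split_finite[OF infsum_mult_bounded(1)[OF w f] G]
    by simp
qed

text \<open>A form of Scheffe's lemma: if nonnegative weights converge pointwise and their total mass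
converges to the mass of the limit, then no mass escapes to infinity, and sums against a bounded
function converge. Outside a finite set carrying almost all of the limiting mass, the weights
have small mass too.\<close>

lemma tendsto_infsum_mult_bounded:
  fixes g :: "'b \<Rightarrow> 'a \<Rightarrow> real"
  assumes g: "\<forall>\<^sub>F t in F. g t summable_on A" "\<forall>\<^sub>F t in F. \<forall>y\<in>A. 0 \<le> g t y"
    and q: "q summable_on A" "\<And>y. y \<in> A \<Longrightarrow> 0 \<le> q y"
    and pointwise: "\<And>y. y \<in> A \<Longrightarrow> ((\<lambda>t. g t y) \<longlongrightarrow> q y) F"
    and mass: "((\<lambda>t. \<Sum>\<^sub>\<infinity>y\<in>A. g t y) \<longlongrightarrow> (\<Sum>\<^sub>\<infinity>y\<in>A. q y)) F"
    and f: "\<And>y. y \<in> A \<Longrightarrow> \<bar>f y\<bar> \<le> B"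
  shows "((\<lambda>t. \<Sum>\<^sub>\<infinity>y\<in>A. g t y * f y) \<longlongrightarrow> (\<Sum>\<^sub>\<infinity>y\<in>A. q y * f y)) F"
proof (rule tendstoI)
  fix \<epsilon> :: real assume "0 < \<epsilon>"
  define C where "C = max B 0"
  have C: "0 \<le> C" "\<And>y. y \<in> A \<Longrightarrow> \<bar>f y\<bar> \<le> C" using f by (auto simp: C_def le_max_iff_disj)
  define \<delta> where "\<delta> = \<epsilon> / (4 * C + 2)"
  have \<delta>: "0 < \<delta>" "\<delta> * (4 * C + 2) = \<epsilon>" using C(1) \<open>0 < \<epsilon>\<close> by (auto simp: \<delta>_def)
  \<comment> \<open>\<open>G\<close> carries all but \<open>\<delta>\<close> of the limiting mass; the weights then have mass below \<open>3 \<delta>\<close> outside \<open>G\<close>.\<close>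
  have "\<forall>\<^sub>F G in finite_subsets_at_top A. dist (sum q G) (\<Sum>\<^sub>\<infinity>y\<in>A. q y) < \<delta>"
    using has_sum_infsum[OF q(1)] \<delta>(1) unfolding has_sum_def by (rule tendstoD)
  then obtain G where G: "finite G" "G \<subseteq> A" "dist (sum q G) (\<Sum>\<^sub>\<infinity>y\<in>A. q y) < \<delta>"
    unfolding eventually_finite_subsets_at_top by blast
  have "((\<lambda>t. \<Sum>y\<in>G. g t y) \<longlongrightarrow> (\<Sum>y\<in>G. q y)) F" "((\<lambda>t. \<Sum>y\<in>G. g t y * f y) \<longlongrightarrow> (\<Sum>y\<in>G. q y * f y)) F"
    using pointwise G(2) by (auto intro!: tendsto_intros)
  from tendstoD[OF this(1) \<delta>(1)] tendstoD[OF this(2) \<delta>(1)] tendstoD[OF mass \<delta>(1)] g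
  show "\<forall>\<^sub>F t in F. dist (\<Sum>\<^sub>\<infinity>y\<in>A. g t y * f y) (\<Sum>\<^sub>\<infinity>y\<in>A. q y * f y) < \<epsilon>"
  proof eventually_elim
    fix t
    assume t: "dist (\<Sum>y\<in>G. g t y) (\<Sum>y\<in>G. q y) < \<delta>"
      "dist (\<Sum>y\<in>G. g t y * f y) (\<Sum>y\<in>G. q y * f y) < \<delta>"
      "dist (\<Sum>\<^sub>\<infinity>y\<in>A. g t y) (\<Sum>\<^sub>\<infinity>y\<in>A. q y) < \<delta>"
      "g t summable_on A" "\<forall>y\<in>A. 0 \<le> g t y"
    have "\<bar>(\<Sum>\<^sub>\<infinity>y\<in>A. g t y * f y) - (\<Sum>y\<in>G. g t y * f y)\<bar> \<le> C * ((\<Sum>\<^sub>\<infinity>y\<in>A. g t y) - (\<Sum>y\<in>G. g t y))"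
      using t C(2) G by (intro infsum_mult_truncation) auto
    also have "\<dots> \<le> C * (3 * \<delta>)"
      using t(1,3) G(3) C(1) by (intro mult_left_mono) (auto simp: dist_real_def)
    finally have 1: "\<bar>(\<Sum>\<^sub>\<infinity>y\<in>A. g t y * f y) - (\<Sum>y\<in>G. g t y * f y)\<bar> \<le> C * (3 * \<delta>)" .
    have "\<bar>(\<Sum>\<^sub>\<infinity>y\<in>A. q y * f y) - (\<Sum>y\<in>G. q y * f y)\<bar> \<le> C * ((\<Sum>\<^sub>\<infinity>y\<in>A. q y) - (\<Sum>y\<in>G. q y))"
      using q C(2) G by (intro infsum_mult_truncation) auto
    also have "\<dots> \<le> C * \<delta>"
      using G(3) C(1) by (intro mult_left_mono) (auto simp: dist_real_def)
    finally have 2: "\<bar>(\<Sum>\<^sub>\<infinity>y\<in>A. q y * f y) - (\<Sum>y\<in>G. q y * f y)\<bar> \<le> C * \<delta>" .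
    have "\<bar>(\<Sum>\<^sub>\<infinity>y\<in>A. g t y * f y) - (\<Sum>\<^sub>\<infinity>y\<in>A. q y * f y)\<bar> < 4 * (C * \<delta>) + 2 * \<delta>"
      using 1 2 t(2) \<delta>(1) unfolding dist_real_def by linarith
    also have "\<dots> = \<epsilon>"
      using \<delta>(2) by (simp add: algebra_simps)
    finally show "dist (\<Sum>\<^sub>\<infinity>y\<in>A. g t y * f y) (\<Sum>\<^sub>\<infinity>y\<in>A. q y * f y) < \<epsilon>"
      by (simp add: dist_real_def)
  qed
qed

lemma rates_nonneg:
  assumes "transition_function S P" "has_rates S P q" "x \<in> S" "y \<in> S - {x}"
  shows "0 \<le> q x y"
proof (rule tendsto_lowerbound)
  show "((\<lambda>t. P t x y / t) \<longlongrightarrow> q x y) (at_right 0)"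
    using assms by (auto simp: has_rates_def)
  show "\<forall>\<^sub>F t in at_right 0. 0 \<le> P t x y / t"
    using eventually_at_right_less[of 0]
    by eventually_elim (use assms in \<open>auto simp: transition_function_def\<close>)
qed simp

text \<open>The rates describe the behaviour at time 0 on points only. The hypothesis that the total rate
out of \<open>x\<close> is the sum of the individual rates excludes an escape of mass, and the preceding lemma
extends the description to bounded functions.\<close>

lemma generator_of_rates:
  assumes P: "transition_function S P" and q: "has_rates S P q" and x: "x \<in> S"
    and f: "\<And>y. \<bar>f y\<bar> \<le> B"
  shows "((\<lambda>t. (mean (kernel S P t x) f - f x) / t) \<longlongrightarrow> (\<Sum>\<^sub>\<infinity>y\<in>S - {x}. q x y * (f y - f x)))
    (at_right 0)"
proof -
  have pos: "\<forall>\<^sub>F t::real in at_right 0. 0 < t"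
    by (rule eventually_at_right_less)
  have summable: "P t x summable_on S" if "0 \<le> t" for t
    using P x that unfolding transition_function_def by (blast intro: has_sum_imp_summable)
  have nonneg: "0 \<le> P t x y" if "0 \<le> t" "y \<in> S" for t y
    using P x that by (auto simp: transition_function_def)
  have total: "(\<Sum>\<^sub>\<infinity>y\<in>S - {x}. P t x y) = 1 - P t x x" if "0 \<le> t" for t
  proof -
    have "(\<Sum>\<^sub>\<infinity>y\<in>S. P t x y) = 1"
      using P x that by (intro infsumI) (auto simp: transition_function_def)
    then show ?thesis
      using infsum_split_finite[OF summable[OF that], of "{x}"] x by simp
  qed
  have fx: "\<bar>f y - f x\<bar> \<le> 2 * B" for y
    using f[of x] f[of y] by linarith
  have limit: "((\<lambda>t. \<Sum>\<^sub>\<infinity>y\<in>S - {x}. P t x y / t * (f y - f x)) \<longlongrightarrow> (\<Sum>\<^sub>\<infinity>y\<in>S - {x}. q x y * (f y - f x)))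
    (at_right 0)"
  proof (rule tendsto_infsum_mult_bounded)
    show "\<forall>\<^sub>F t in at_right 0. (\<lambda>y. P t x y / t) summable_on S - {x}"
      using pos by eventually_elim
        (use summable in \<open>auto simp: divide_inverse intro!: summable_on_cmult_left summable_on_subset_banach[where B = "S - {x}" and A = S]\<close>)
    show "\<forall>\<^sub>F t in at_right 0. \<forall>y\<in>S - {x}. 0 \<le> P t x y / t"
      using pos by eventually_elim (use nonneg in auto)
    show "((\<lambda>t. \<Sum>\<^sub>\<infinity>y\<in>S - {x}. P t x y / t) \<longlongrightarrow> (\<Sum>\<^sub>\<infinity>y\<in>S - {x}. q x y)) (at_right 0)"
    proof (rule Lim_transform_eventually)
      show "((\<lambda>t. (1 - P t x x) / t) \<longlongrightarrow> (\<Sum>\<^sub>\<infinity>y\<in>S - {x}. q x y)) (at_right 0)"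
        using q x by (auto simp: has_rates_def)
      show "\<forall>\<^sub>F t in at_right 0. (1 - P t x x) / t = (\<Sum>\<^sub>\<infinity>y\<in>S - {x}. P t x y / t)"
        using pos by eventually_elim (simp add: total divide_inverse infsum_cmult_left')
    qed
  qed (use q x fx rates_nonneg[OF P q x] in \<open>auto simp: has_rates_def\<close>)
  show ?thesis
  proof (rule Lim_transform_eventually[OF limit])
    show "\<forall>\<^sub>F t in at_right 0. (\<Sum>\<^sub>\<infinity>y\<in>S - {x}. P t x y / t * (f y - f x)) = (mean (kernel S P t x) f - f x) / t"
      using pos
    proof eventually_elim
      fix t :: real assume t: "0 < t"
      have "mean (kernel S P t x) f - f x = mean (kernel S P t x) (\<lambda>y. f y - f x)"
        by (subst mean_diff[where B = B and B' = B]) (use f in auto)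
      also have "\<dots> = (\<Sum>\<^sub>\<infinity>y\<in>S. pmf (kernel S P t x) y * (f y - f x))"
        by (rule mean_eq_infsum[OF set_kernel]) (use P x t fx in auto)
      also have "\<dots> = (\<Sum>\<^sub>\<infinity>y\<in>S - {x}. P t x y * (f y - f x))"
        by (rule infsum_cong_neutral) (use P x t in \<open>auto simp: pmf_kernel\<close>)
      also have "\<dots> / t = (\<Sum>\<^sub>\<infinity>y\<in>S - {x}. P t x y * (f y - f x) * inverse t)"
        by (simp add: infsum_cmult_left' divide_inverse)
      finally show "(\<Sum>\<^sub>\<infinity>y\<in>S - {x}. P t x y / t * (f y - f x)) = (mean (kernel S P t x) f - f x) / t"
        by (simp add: divide_inverse mult_ac)
    qed
  qed
qed

section \<open>The absorbed chain and its conditioned law\<close>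

text \<open>The bound \<open>c\<close> on the rates is taken to be at least 1 so that one may divide by it; positivity of the
return probabilities makes the survival probability positive, so that conditioning is possible.\<close>

locale absorbed_chain =
  fixes \<Lambda> :: "'a set" and z :: 'a
    and P :: "real \<Rightarrow> 'a \<Rightarrow> 'a \<Rightarrow> real" and q :: "'a \<Rightarrow> 'a \<Rightarrow> real" and c :: real
  assumes z_notin: "z \<notin> \<Lambda>"
    and transition: "transition_function (insert z \<Lambda>) P"
    and rates: "has_rates (insert z \<Lambda>) P q"
    and absorbing: "x \<in> \<Lambda> \<Longrightarrow> q z x = 0"
    and total_rate: "x \<in> \<Lambda> \<Longrightarrow> (\<Sum>\<^sub>\<infinity>y\<in>insert z \<Lambda> - {x}. q x y) \<le> c"
    and c_ge_1: "1 \<le> c"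
    and stay_pos: "0 < t \<Longrightarrow> x \<in> \<Lambda> \<Longrightarrow> 0 < P t x x"
begin

abbreviation K :: "real \<Rightarrow> 'a \<Rightarrow> 'a pmf" where
  "K \<equiv> kernel (insert z \<Lambda>) P"

lemma leaving_rate_limit:
  assumes "x \<in> insert z \<Lambda>"
  shows "((\<lambda>t. (1 - pmf (K t x) x) / t) \<longlongrightarrow> (\<Sum>\<^sub>\<infinity>y\<in>insert z \<Lambda> - {x}. q x y)) (at_right 0)"
proof (rule Lim_transform_eventually)
  show "((\<lambda>t. (1 - P t x x) / t) \<longlongrightarrow> (\<Sum>\<^sub>\<infinity>y\<in>insert z \<Lambda> - {x}. q x y)) (at_right 0)"
    using rates assms unfolding has_rates_def by blast
  show "\<forall>\<^sub>F t in at_right 0. (1 - P t x x) / t = (1 - pmf (K t x) x) / t"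
    using eventually_at_right_less[of 0]
    by eventually_elim (use assms transition in \<open>simp add: pmf_kernel\<close>)
qed

lemma no_leaving_rate: "(\<Sum>\<^sub>\<infinity>y\<in>insert z \<Lambda> - {z}. q z y) = 0"
  by (rule infsum_0) (use absorbing in auto)

sublocale bounded_rate_semigroup K c
proof
  fix x
  show "\<exists>r\<le>c. ((\<lambda>t. (1 - pmf (K t x) x) / t) \<longlongrightarrow> r) (at_right 0)"
  proof (cases "x \<in> insert z \<Lambda>")
    case True
    then have "(\<Sum>\<^sub>\<infinity>y\<in>insert z \<Lambda> - {x}. q x y) \<le> c"
      using total_rate[of x] no_leaving_rate c_ge_1 by (cases "x = z") auto
    then show ?thesis using leaving_rate_limit[OF True] by blast
  next
    case False
    then show ?thesis using c_ge_1 by (intro exI[of _ 0]) (auto simp: kernel_def)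
  qed
qed (use kernel_0[OF transition] kernel_add[OF transition] in auto)

text \<open>The total rate out of \<open>z\<close> is 0, so \<open>z\<close> is never left; all other points outside \<open>\<Lambda>\<close> are fixed by the
convention on kernels.\<close>

lemma K_outside:
  assumes "x \<notin> \<Lambda>" "0 \<le> t"
  shows "K t x = return_pmf x"
proof (cases "x = z")
  case True
  have "1 - pmf (K t z) z \<le> 0 * t"
    using assms(2) leaving_rate_limit[of z] unfolding no_leaving_rate
    by (intro leaving_probability) auto
  then have "pmf (K t z) z = 1"
    using pmf_le_1[of "K t z" z] by simp
  then have "AE y in K t z. y \<in> {z}"
    by (intro measure_pmf.AE_prob_1) (simp add: pmf.rep_eq)
  then have "set_pmf (K t z) \<subseteq> {z}"
    by (auto simp: AE_measure_pmf_iff)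
  then show ?thesis
    using True by (simp add: set_pmf_subset_singleton)
qed (use assms in \<open>auto simp: kernel_def\<close>)

text \<open>Functions on \<open>\<Lambda>\<close>, extended by 0 to the absorbing state, so that \<open>P\<^sub>t f\<close> is the mean of \<open>f\<close> over the
paths that survive. Up to normalisation the class is preserved by the generator and contains the
killing rate, which closes the system of inequalities.\<close>

definition test_function :: "('a \<Rightarrow> real) \<Rightarrow> bool" where
  "test_function f \<longleftrightarrow> (\<forall>x. \<bar>f x\<bar> \<le> 1) \<and> (\<forall>x. x \<notin> \<Lambda> \<longrightarrow> f x = 0)"

text \<open>The sum includes \<open>y = z\<close>: for test functions this term is the loss \<open>- q x z * f x\<close> by killing.\<close>

definition generator :: "('a \<Rightarrow> real) \<Rightarrow> 'a \<Rightarrow> real" where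
  "generator f x = (if x \<in> \<Lambda> then \<Sum>\<^sub>\<infinity>y\<in>insert z \<Lambda> - {x}. q x y * (f y - f x) else 0)"

definition killing :: "'a \<Rightarrow> real" where
  "killing x = (if x \<in> \<Lambda> then q x z else 0)"

lemma test_abs_le: "test_function f \<Longrightarrow> \<bar>f x\<bar> \<le> 1"
  and test_outside: "test_function f \<Longrightarrow> x \<notin> \<Lambda> \<Longrightarrow> f x = 0"
  by (auto simp: test_function_def)

lemma test_diff_le: "test_function f \<Longrightarrow> \<bar>f x - f y\<bar> \<le> 2"
  using test_abs_le[of f x] test_abs_le[of f y] by linarith

lemma q_nonneg: "x \<in> \<Lambda> \<Longrightarrow> y \<in> insert z \<Lambda> - {x} \<Longrightarrow> 0 \<le> q x y"
  using rates_nonneg[OF transition rates] by blast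

lemma q_summable: "x \<in> \<Lambda> \<Longrightarrow> q x summable_on insert z \<Lambda> - {x}"
  using rates by (auto simp: has_rates_def)

lemma generator_le:
  assumes "test_function f"
  shows "\<bar>generator f x\<bar> \<le> 2 * c"
proof (cases "x \<in> \<Lambda>")
  case True
  have "\<bar>\<Sum>\<^sub>\<infinity>y\<in>insert z \<Lambda> - {x}. q x y * (f y - f x)\<bar> \<le> 2 * (\<Sum>\<^sub>\<infinity>y\<in>insert z \<Lambda> - {x}. q x y)"
    using True q_summable q_nonneg test_diff_le[OF assms] by (intro infsum_mult_bounded) auto
  with total_rate[OF True] True show ?thesis by (simp add: generator_def)
qed (use c_ge_1 in \<open>simp add: generator_def\<close>)

lemma killing_nonneg: "0 \<le> killing x" and killing_le: "killing x \<le> c"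
proof -
  show "0 \<le> killing x" using q_nonneg[of x z] z_notin by (auto simp: killing_def)
  show "killing x \<le> c"
  proof (cases "x \<in> \<Lambda>")
    case True
    have "(\<Sum>\<^sub>\<infinity>y\<in>{z}. q x y) \<le> (\<Sum>\<^sub>\<infinity>y\<in>insert z \<Lambda> - {x}. q x y)"
      using True z_notin q_summable q_nonneg by (intro infsum_mono2) auto
    with total_rate[OF True] True show ?thesis by (simp add: killing_def)
  qed (use c_ge_1 in \<open>simp add: killing_def\<close>)
qed

lemma test_generator: "test_function f \<Longrightarrow> test_function (\<lambda>x. generator f x / (2 * c))"
  using generator_le[of f] c_ge_1 by (auto simp: test_function_def generator_def abs_mult)

lemma test_killing: "test_function (\<lambda>x. killing x / c)"
  using killing_nonneg killing_le c_ge_1 by (auto simp: test_function_def killing_def)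

lemma test_indicator: "B \<subseteq> \<Lambda> \<Longrightarrow> test_function (indicator B)"
  by (auto simp: test_function_def indicator_def)

lemma generator_indicator: "generator (indicator \<Lambda>) = (\<lambda>x. - killing x)"
proof
  fix x
  show "generator (indicator \<Lambda>) x = - killing x"
  proof (cases "x \<in> \<Lambda>")
    case True
    have "(\<Sum>\<^sub>\<infinity>y\<in>insert z \<Lambda> - {x}. q x y * (indicator \<Lambda> y - indicator \<Lambda> x))
        = (\<Sum>\<^sub>\<infinity>y\<in>{z}. q x y * (indicator \<Lambda> y - indicator \<Lambda> x))"
      by (rule infsum_cong_neutral) (use True z_notin in \<open>auto simp: indicator_def\<close>)
    then show ?thesis using True z_notin by (simp add: generator_def killing_def)
  qed (simp add: generator_def killing_def)
qed

lemma generator_limit: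
  assumes "test_function f"
  shows "((\<lambda>t. (mean (K t x) f - f x) / t) \<longlongrightarrow> generator f x) (at_right 0)"
proof (cases "x \<in> \<Lambda>")
  case True
  then show ?thesis
    using generator_of_rates[OF transition rates, of x f 1] test_abs_le[OF assms]
    by (simp add: generator_def)
next
  case False
  have "\<forall>\<^sub>F t in at_right 0. generator f x = (mean (K t x) f - f x) / t"
    using eventually_at_right_less[of 0]
    by eventually_elim (use False in \<open>simp add: K_outside generator_def\<close>)
  then show ?thesis
    by (rule Lim_transform_eventually[OF tendsto_const])
qed

text \<open>The indicator on the right matters: the error is again carried by the surviving paths, so it
remains of the same size after division by a small survival probability.\<close>

lemma K_expansion:
  assumes "test_function f" "0 \<le> h"
  shows "\<bar>mean (K h x) f - f x - h * generator f x\<bar> \<le> 4 * c\<^sup>2 * h\<^sup>2 * indicator \<Lambda> x"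
proof (cases "x \<in> \<Lambda>")
  case True
  then show ?thesis
    using second_order[of h f 1 x, OF assms(2) test_abs_le[OF assms(1)] generator_limit[OF assms(1)]] by simp
next
  case False
  then show ?thesis using assms(2) by (simp add: K_outside generator_def)
qed

definition law :: "'a pmf \<Rightarrow> real \<Rightarrow> 'a pmf" where
  "law \<mu> t = bind_pmf \<mu> (K t)"

definition cond_mean :: "'a pmf \<Rightarrow> real \<Rightarrow> ('a \<Rightarrow> real) \<Rightarrow> real" where
  "cond_mean \<mu> t f = mean (law \<mu> t) f / mean (law \<mu> t) (indicator \<Lambda>)"

lemma law_add:
  assumes "0 \<le> s" "0 \<le> h" "\<And>x. \<bar>f x\<bar> \<le> B"
  shows "mean (law \<mu> (s + h)) f = mean (law \<mu> s) (\<lambda>x. mean (K h x) f)"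
proof -
  have "law \<mu> (s + h) = bind_pmf (law \<mu> s) (K h)"
    using assms by (simp add: law_def K_add bind_assoc_pmf cong: bind_pmf_cong)
  then show ?thesis by (simp add: mean_bind[OF assms(3)])
qed

lemma alive_pos:
  assumes "set_pmf \<mu> \<subseteq> \<Lambda>" "0 \<le> t"
  shows "0 < mean (law \<mu> t) (indicator \<Lambda>)"
proof -
  obtain x where x: "x \<in> set_pmf \<mu>" using set_pmf_not_empty[of \<mu>] by blast
  then have "x \<in> \<Lambda>" using assms by auto
  have "0 < P t x x"
    using stay_pos[OF _ \<open>x \<in> \<Lambda>\<close>] transition \<open>x \<in> \<Lambda>\<close> assms(2)
    by (cases "t = 0") (auto simp: transition_function_def)
  then have "x \<in> set_pmf (K t x)"
    using \<open>x \<in> \<Lambda>\<close> transition assms(2) by (simp add: set_pmf_iff pmf_kernel)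
  then have "x \<in> set_pmf (law \<mu> t)" using x by (auto simp: law_def)
  then have "0 < pmf (law \<mu> t) x" by (simp add: pmf_positive)
  also have "\<dots> \<le> measure (law \<mu> t) \<Lambda>"
    unfolding pmf.rep_eq using \<open>x \<in> \<Lambda>\<close> by (intro measure_pmf.finite_measure_mono) auto
  finally show ?thesis by simp
qed

lemma cond_abs_le:
  assumes "set_pmf \<mu> \<subseteq> \<Lambda>" "0 \<le> t" "\<And>x. \<bar>f x\<bar> \<le> B * indicator \<Lambda> x"
  shows "\<bar>cond_mean \<mu> t f\<bar> \<le> B"
proof -
  have B: "\<bar>f x\<bar> \<le> \<bar>B\<bar>" for x using assms(3)[of x] by (cases "x \<in> \<Lambda>") auto
  have "\<bar>mean (law \<mu> t) f\<bar> \<le> mean (law \<mu> t) (\<lambda>x. \<bar>f x\<bar>)" by simp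
  also have "\<dots> \<le> mean (law \<mu> t) (\<lambda>x. B * indicator \<Lambda> x)"
    by (rule mean_mono[where B = "\<bar>B\<bar>" and B' = "\<bar>B\<bar>"]) (use assms(3) B in \<open>auto simp: abs_mult indicator_def\<close>)
  finally show ?thesis
    using alive_pos[OF assms(1,2)] by (simp add: cond_mean_def abs_divide divide_le_eq)
qed

lemma test_le_indicator: "test_function f \<Longrightarrow> \<bar>f x\<bar> \<le> 1 * indicator \<Lambda> x"
  by (auto simp: test_function_def indicator_def)

lemma generator_le_indicator: "test_function f \<Longrightarrow> \<bar>generator f x\<bar> \<le> 2 * c * indicator \<Lambda> x"
  using generator_le[of f x] by (auto simp: generator_def indicator_def)

lemma killing_le_indicator: "\<bar>killing x\<bar> \<le> c * indicator \<Lambda> x"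
  using killing_le[of x] killing_nonneg[of x] by (auto simp: killing_def indicator_def)

lemma cond_cmult: "cond_mean \<mu> t (\<lambda>x. f x / a) = cond_mean \<mu> t f / a"
  by (simp add: cond_mean_def)

text \<open>The evolution up to time \<open>s + h\<close>, normalised by the survival probability at the earlier time \<open>s\<close>,
is linear in \<open>f\<close> and therefore follows the generator. For \<open>f = indicator \<Lambda>\<close> it is the ratio of the
two survival probabilities.\<close>

lemma cond_mean_numerator_expansion:
  assumes \<mu>: "set_pmf \<mu> \<subseteq> \<Lambda>" and s: "0 \<le> s" and h: "0 \<le> h" and f: "test_function f"
  shows "\<bar>mean (law \<mu> (s + h)) f / mean (law \<mu> s) (indicator \<Lambda>) - cond_mean \<mu> s f - h * cond_mean \<mu> s (generator f)\<bar>
    \<le> 4 * c\<^sup>2 * h\<^sup>2"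
proof -
  define r where "r x = mean (K h x) f - f x - h * generator f x" for x
  have r: "\<bar>r x\<bar> \<le> 4 * c\<^sup>2 * h\<^sup>2 * indicator \<Lambda> x" for x
    unfolding r_def by (rule K_expansion[OF f h])
  have r': "\<bar>r x\<bar> \<le> 4 * c\<^sup>2 * h\<^sup>2" for x
    using r[of x] by (auto simp: indicator_def split: if_splits intro: order_trans)
  have g: "\<bar>h * generator f x\<bar> \<le> h * (2 * c)" for x
    using generator_le[OF f, of x] h by (simp add: abs_mult mult_left_mono)
  have fg: "\<bar>f x + h * generator f x\<bar> \<le> 1 + h * (2 * c)" for x
    using g[of x] test_abs_le[OF f, of x] by linarith
  have "mean (law \<mu> (s + h)) f = mean (law \<mu> s) (\<lambda>x. f x + h * generator f x + r x)"
    using law_add[OF s h test_abs_le[OF f]] by (simp add: r_def)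
  also have "\<dots> = mean (law \<mu> s) f + h * mean (law \<mu> s) (generator f) + mean (law \<mu> s) r"
    by (simp add: mean_add[OF fg r'] mean_add[OF test_abs_le[OF f] g])
  finally have "mean (law \<mu> (s + h)) f / mean (law \<mu> s) (indicator \<Lambda>)
      = cond_mean \<mu> s f + h * cond_mean \<mu> s (generator f) + cond_mean \<mu> s r"
    by (simp add: cond_mean_def add_divide_distrib)
  then show ?thesis
    using cond_abs_le[OF \<mu> s r] by simp
qed

text \<open>One Euler step of \<open>d/ds \<phi>\<^sub>s(f) = \<phi>\<^sub>s(A f) + \<phi>\<^sub>s(k) \<phi>\<^sub>s(f)\<close>. The new value \<open>p'\<close> satisfies
\<open>p' d = p + h A + O(h\<^sup>2)\<close> with the ratio of survival probabilities \<open>d = 1 - h k + O(h\<^sup>2)\<close>. Since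
\<open>p'\<close> is known to be at most 1 in modulus, the equation is used in this multiplied form.\<close>

lemma cond_mean_step:
  assumes \<mu>: "set_pmf \<mu> \<subseteq> \<Lambda>" and s: "0 \<le> s" and h: "0 \<le> h" "h \<le> 1" and f: "test_function f"
  shows "\<bar>cond_mean \<mu> (s + h) f - cond_mean \<mu> s f - h * (cond_mean \<mu> s (generator f) + cond_mean \<mu> s killing * cond_mean \<mu> s f)\<bar>
    \<le> (11 * c\<^sup>2 + 8 * c ^ 3) * h\<^sup>2"
proof -
  define p where "p = cond_mean \<mu> s f"
  define p' where "p' = cond_mean \<mu> (s + h) f"
  define A where "A = cond_mean \<mu> s (generator f)"
  define k where "k = cond_mean \<mu> s killing"
  define d where "d = mean (law \<mu> (s + h)) (indicator \<Lambda>) / mean (law \<mu> s) (indicator \<Lambda>)"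
  define e1 where "e1 = p' * d - p - h * A"
  define e2 where "e2 = d - 1 + h * k"
  have pos: "0 < mean (law \<mu> s) (indicator \<Lambda>)" "0 < mean (law \<mu> (s + h)) (indicator \<Lambda>)"
    by (rule alive_pos; use \<mu> s h in simp)+
  have "p' * d = mean (law \<mu> (s + h)) f / mean (law \<mu> s) (indicator \<Lambda>)"
    using pos by (simp add: p'_def d_def cond_mean_def)
  then have e1: "\<bar>e1\<bar> \<le> 4 * c\<^sup>2 * h\<^sup>2"
    using cond_mean_numerator_expansion[OF \<mu> s h(1) f] by (simp add: e1_def p_def A_def)
  have "cond_mean \<mu> s (indicator \<Lambda>) = 1" "cond_mean \<mu> s (generator (indicator \<Lambda>)) = - k"
    using pos by (auto simp: cond_mean_def generator_indicator k_def)
  then have e2: "\<bar>e2\<bar> \<le> 4 * c\<^sup>2 * h\<^sup>2"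
    using cond_mean_numerator_expansion[OF \<mu> s h(1) test_indicator[OF order_refl]] by (simp add: e2_def d_def)
  have p': "\<bar>p'\<bar> \<le> 1" and A: "\<bar>A\<bar> \<le> 2 * c" and k: "\<bar>k\<bar> \<le> c"
    unfolding p'_def A_def k_def
    using \<mu> s h cond_abs_le[OF _ _ test_le_indicator[OF f]] cond_abs_le[OF _ _ generator_le_indicator[OF f]]
      cond_abs_le[OF _ _ killing_le_indicator] by auto
  have mult: "\<bar>a * b\<bar> \<le> u * v" if "\<bar>a\<bar> \<le> u" "\<bar>b\<bar> \<le> v" for a b u v :: real
    using that by (simp add: abs_mult mult_mono')
  \<comment> \<open>Since \<open>h \<le> 1\<close>, the error \<open>O(h\<^sup>2)\<close> in the speed is absorbed into \<open>O(h)\<close>.\<close>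
  have hh: "h * h \<le> h" using h by (simp add: mult_left_le)
  have diff: "p' - p = h * A + e1 + p' * (h * k - e2)"
    by (simp add: e1_def e2_def algebra_simps)
  have "\<bar>h * k - e2\<bar> \<le> h * c + 4 * c\<^sup>2 * h\<^sup>2"
    using mult[of h h k c] k e2 h by linarith
  then have "\<bar>p' * (h * k - e2)\<bar> \<le> 1 * (h * c + 4 * c\<^sup>2 * h\<^sup>2)"
    by (rule mult[OF p'])
  then have "\<bar>p' - p\<bar> \<le> 3 * c * h + 8 * c\<^sup>2 * h\<^sup>2"
    using diff e1 mult[of h h A "2 * c"] A h by (simp add: mult_ac)
  also have "\<dots> \<le> 3 * c * h + 8 * c\<^sup>2 * h"
    using hh by (simp add: power2_eq_square mult_left_mono)
  finally have "\<bar>k * (p' - p)\<bar> \<le> c * (3 * c * h + 8 * c\<^sup>2 * h)"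
    by (rule mult[OF k])
  then have "\<bar>h * (k * (p' - p))\<bar> \<le> h * (c * (3 * c * h + 8 * c\<^sup>2 * h))"
    using h by (intro mult[of h h "k * (p' - p)"]) auto
  moreover have "\<bar>p' * e2\<bar> \<le> 1 * (4 * c\<^sup>2 * h\<^sup>2)"
    by (rule mult[OF p' e2])
  moreover have "p' - p - h * (A + k * p) = e1 - p' * e2 + h * (k * (p' - p))"
    using diff by (simp add: algebra_simps)
  ultimately have "\<bar>p' - p - h * (A + k * p)\<bar> \<le> 4 * c\<^sup>2 * h\<^sup>2 + 4 * c\<^sup>2 * h\<^sup>2 + h * (c * (3 * c * h + 8 * c\<^sup>2 * h))"
    using e1 by linarith
  also have "\<dots> = (11 * c\<^sup>2 + 8 * c ^ 3) * h\<^sup>2"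
    by (simp add: power2_eq_square power3_eq_cube algebra_simps)
  finally show ?thesis by (simp add: p_def p'_def A_def k_def)
qed

end

section \<open>The generator of the particle system on empirical means\<close>

lemma has_sum_finite_sum:
  fixes g :: "'i \<Rightarrow> 'a \<Rightarrow> real"
  assumes "finite I" "\<And>i. i \<in> I \<Longrightarrow> (g i has_sum s i) A"
  shows "((\<lambda>y. \<Sum>i\<in>I. g i y) has_sum (\<Sum>i\<in>I. s i)) A"
  using assms by (induction I rule: finite_induct) (auto intro: has_sum_add)

definition empirical :: "nat \<Rightarrow> ('a \<Rightarrow> real) \<Rightarrow> (nat \<Rightarrow> 'a) \<Rightarrow> real" where
  "empirical N f \<xi> = (\<Sum>i=1..N. f (\<xi> i)) / real N"

lemma empirical_abs_le:
  assumes "1 \<le> N" "\<And>i. i \<in> {1..N} \<Longrightarrow> \<bar>f (\<xi> i)\<bar> \<le> B"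
  shows "\<bar>empirical N f \<xi>\<bar> \<le> B"
proof -
  have "\<bar>\<Sum>i=1..N. f (\<xi> i)\<bar> \<le> (\<Sum>i=1..N. B)"
    using assms(2) by (intro order_trans[OF sum_abs sum_mono])
  then show ?thesis
    using assms(1) by (simp add: empirical_def abs_divide divide_le_eq mult.commute)
qed

lemma empirical_move:
  assumes "i \<in> {1..N}"
  shows "empirical N f (\<xi>(i := y)) = empirical N f \<xi> + (f y - f (\<xi> i)) / real N"
proof -
  have "(\<Sum>j=1..N. f ((\<xi>(i := y)) j)) - (\<Sum>j=1..N. f (\<xi> j)) = (\<Sum>j=1..N. if j = i then f y - f (\<xi> i) else 0)"
    unfolding sum_subtractf[symmetric] by (rule sum.cong) auto
  also have "\<dots> = f y - f (\<xi> i)"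
    using assms by simp
  finally show ?thesis
    by (simp add: empirical_def diff_divide_distrib[symmetric] add_divide_distrib[symmetric] algebra_simps)
qed

context absorbed_chain
begin

text \<open>The contribution of the moves of particle \<open>i\<close> to the generator, as a functional of the increment
\<open>G y\<close> caused by moving the particle to \<open>y\<close>.\<close>

definition particle_generator :: "nat \<Rightarrow> (nat \<Rightarrow> 'a) \<Rightarrow> nat \<Rightarrow> ('a \<Rightarrow> real) \<Rightarrow> real" where
  "particle_generator N \<xi> i G = (\<Sum>\<^sub>\<infinity>y\<in>\<Lambda> - {\<xi> i}.
     (q (\<xi> i) y + q (\<xi> i) z * (occupation N \<xi> y / (real N - 1))) * G y)"

lemma fv_generator_eq_sum:
  "fv_generator \<Lambda> z q N F \<xi> = (\<Sum>i=1..N. particle_generator N \<xi> i (\<lambda>y. F (\<xi>(i := y)) - F \<xi>))"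
  by (simp add: fv_generator_def particle_generator_def)

lemma q_summable_inside: "x \<in> \<Lambda> \<Longrightarrow> q x summable_on \<Lambda> - {x}"
  using q_summable[of x] by (rule summable_on_subset_banach) auto

lemma rate_split: "x \<in> \<Lambda> \<Longrightarrow> (\<Sum>\<^sub>\<infinity>y\<in>insert z \<Lambda> - {x}. q x y) = q x z + (\<Sum>\<^sub>\<infinity>y\<in>\<Lambda> - {x}. q x y)"
  using infsum_split_finite[OF q_summable, of x "{z}"] z_notin
  by (auto simp: insert_Diff_if)

text \<open>Summing over sites with the occupation numbers as weights is summing over particles. The
increment vanishes at the present position, so the excluded site \<open>\<xi> i\<close> may be put back.\<close>

lemma particle_generator_eq:
  assumes \<xi>: "\<xi> \<in> {1..N} \<rightarrow>\<^sub>E \<Lambda>" and i: "i \<in> {1..N}"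
    and G: "\<And>y. \<bar>G y\<bar> \<le> B" "G (\<xi> i) = 0"
  shows "particle_generator N \<xi> i G = (\<Sum>\<^sub>\<infinity>y\<in>\<Lambda> - {\<xi> i}. q (\<xi> i) y * G y)
    + killing (\<xi> i) / (real N - 1) * (\<Sum>j=1..N. G (\<xi> j))"
proof -
  have x: "\<xi> i \<in> \<Lambda>" using \<xi> i by auto
  have "((\<lambda>y. of_bool (\<xi> j = y) * G y) has_sum G (\<xi> j)) (\<Lambda> - {\<xi> i})" if "j \<in> {1..N}" for j
    by (rule has_sum_finite_neutralI[where B = "{\<xi> j} - {\<xi> i}"])
       (use \<xi> that G(2) in \<open>auto simp: insert_Diff_if\<close>)
  then have "((\<lambda>y. \<Sum>j=1..N. of_bool (\<xi> j = y) * G y) has_sum (\<Sum>j=1..N. G (\<xi> j))) (\<Lambda> - {\<xi> i})"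
    by (intro has_sum_finite_sum) auto
  then have "((\<lambda>y. killing (\<xi> i) / (real N - 1) * (\<Sum>j=1..N. of_bool (\<xi> j = y) * G y))
      has_sum killing (\<xi> i) / (real N - 1) * (\<Sum>j=1..N. G (\<xi> j))) (\<Lambda> - {\<xi> i})"
    by (rule has_sum_cmult_right)
  moreover have "((\<lambda>y. q (\<xi> i) y * G y) has_sum (\<Sum>\<^sub>\<infinity>y\<in>\<Lambda> - {\<xi> i}. q (\<xi> i) y * G y)) (\<Lambda> - {\<xi> i})"
    using x G(1) q_nonneg q_summable_inside by (intro has_sum_infsum infsum_mult_bounded) auto
  ultimately have "((\<lambda>y. q (\<xi> i) y * G y + killing (\<xi> i) / (real N - 1) * (\<Sum>j=1..N. of_bool (\<xi> j = y) * G y))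
      has_sum (\<Sum>\<^sub>\<infinity>y\<in>\<Lambda> - {\<xi> i}. q (\<xi> i) y * G y) + killing (\<xi> i) / (real N - 1) * (\<Sum>j=1..N. G (\<xi> j)))
      (\<Lambda> - {\<xi> i})"
    by (intro has_sum_add)
  moreover have "q (\<xi> i) y * G y + killing (\<xi> i) / (real N - 1) * (\<Sum>j=1..N. of_bool (\<xi> j = y) * G y)
     = (q (\<xi> i) y + q (\<xi> i) z * (occupation N \<xi> y / (real N - 1))) * G y" for y
    using x by (simp add: killing_def occupation_def sum_distrib_right[symmetric] algebra_simps)
  ultimately show ?thesis
    unfolding particle_generator_def by (simp only: infsumI)
qed

text \<open>The particle moves by itself at rate at most \<open>c\<close> and is replaced at rate at most
\<open>c N / (N - 1) \<le> 2 c\<close>.\<close>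

lemma particle_generator_le:
  assumes N: "2 \<le> N" and \<xi>: "\<xi> \<in> {1..N} \<rightarrow>\<^sub>E \<Lambda>" and i: "i \<in> {1..N}"
    and G: "\<And>y. \<bar>G y\<bar> \<le> B" "G (\<xi> i) = 0"
  shows "\<bar>particle_generator N \<xi> i G\<bar> \<le> 3 * c * B"
proof -
  have x: "\<xi> i \<in> \<Lambda>" using \<xi> i by auto
  have B: "0 \<le> B" using G(1)[of z] by linarith
  have "0 \<le> q (\<xi> i) z" using q_nonneg[OF x, of z] x z_notin by blast
  have "\<bar>\<Sum>\<^sub>\<infinity>y\<in>\<Lambda> - {\<xi> i}. q (\<xi> i) y * G y\<bar> \<le> B * (\<Sum>\<^sub>\<infinity>y\<in>\<Lambda> - {\<xi> i}. q (\<xi> i) y)"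
    using x G(1) q_nonneg q_summable_inside by (intro infsum_mult_bounded) auto
  also have "\<dots> \<le> B * c"
    using total_rate[OF x] rate_split[OF x] \<open>0 \<le> q (\<xi> i) z\<close> B
    by (intro mult_left_mono) auto
  finally have 1: "\<bar>\<Sum>\<^sub>\<infinity>y\<in>\<Lambda> - {\<xi> i}. q (\<xi> i) y * G y\<bar> \<le> c * B" by (simp only: mult.commute)
  have "\<bar>\<Sum>j=1..N. G (\<xi> j)\<bar> \<le> (\<Sum>j=1..N. B)"
    using G(1) by (intro order_trans[OF sum_abs sum_mono])
  then have S: "\<bar>\<Sum>j=1..N. G (\<xi> j)\<bar> \<le> real N * B" by simp
  have "\<bar>killing (\<xi> i) / (real N - 1) * (\<Sum>j=1..N. G (\<xi> j))\<bar> \<le> (c / (real N - 1)) * (real N * B)"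
    unfolding abs_mult
    using N killing_nonneg killing_le S c_ge_1 by (intro mult_mono) (auto simp: abs_divide divide_right_mono)
  also have "\<dots> = (c * B) * (real N / (real N - 1))" by simp
  also have "\<dots> \<le> (c * B) * 2"
    using N B c_ge_1 by (intro mult_left_mono) (auto simp: divide_le_eq)
  finally have 2: "\<bar>killing (\<xi> i) / (real N - 1) * (\<Sum>j=1..N. G (\<xi> j))\<bar> \<le> (c * B) * 2" .
  have "\<bar>particle_generator N \<xi> i G\<bar> \<le> c * B + (c * B) * 2"
    unfolding particle_generator_eq[where G = G, OF \<xi> i G] by (rule order_trans[OF abs_triangle_ineq add_mono[OF 1 2]])
  then show ?thesis by (simp add: mult_ac)
qed

lemma particle_generator_linear:
  assumes N: "2 \<le> N" and \<xi>: "\<xi> \<in> {1..N} \<rightarrow>\<^sub>E \<Lambda>" and i: "i \<in> {1..N}"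
    and G: "\<And>y. \<bar>G y\<bar> \<le> B" "G (\<xi> i) = 0" and H: "\<And>y. \<bar>H y\<bar> \<le> B'" "H (\<xi> i) = 0"
  shows "particle_generator N \<xi> i (\<lambda>y. a * G y + b * H y) = a * particle_generator N \<xi> i G + b * particle_generator N \<xi> i H"
proof -
  have x: "\<xi> i \<in> \<Lambda>" using \<xi> i by auto
  have bound: "\<bar>a * G y + b * H y\<bar> \<le> \<bar>a\<bar> * B + \<bar>b\<bar> * B'" for y
    using mult_left_mono[OF G(1)[of y], of "\<bar>a\<bar>"] mult_left_mono[OF H(1)[of y], of "\<bar>b\<bar>"]
      abs_triangle_ineq[of "a * G y" "b * H y"] by (simp add: abs_mult)
  have GH: "(\<lambda>y. q (\<xi> i) y * G y) summable_on (\<Lambda> - {\<xi> i})" "(\<lambda>y. q (\<xi> i) y * H y) summable_on (\<Lambda> - {\<xi> i})"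
    using x G(1) H(1) q_nonneg q_summable_inside by (intro infsum_mult_bounded; auto)+
  have "(\<Sum>\<^sub>\<infinity>y\<in>\<Lambda> - {\<xi> i}. q (\<xi> i) y * (a * G y + b * H y))
      = (\<Sum>\<^sub>\<infinity>y\<in>\<Lambda> - {\<xi> i}. a * (q (\<xi> i) y * G y) + b * (q (\<xi> i) y * H y))"
    by (rule infsum_cong) (simp add: algebra_simps)
  also have "\<dots> = a * (\<Sum>\<^sub>\<infinity>y\<in>\<Lambda> - {\<xi> i}. q (\<xi> i) y * G y) + b * (\<Sum>\<^sub>\<infinity>y\<in>\<Lambda> - {\<xi> i}. q (\<xi> i) y * H y)"
    using GH by (simp add: infsum_add summable_on_cmult_right infsum_cmult_right')
  finally have inf: "(\<Sum>\<^sub>\<infinity>y\<in>\<Lambda> - {\<xi> i}. q (\<xi> i) y * (a * G y + b * H y))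
      = a * (\<Sum>\<^sub>\<infinity>y\<in>\<Lambda> - {\<xi> i}. q (\<xi> i) y * G y) + b * (\<Sum>\<^sub>\<infinity>y\<in>\<Lambda> - {\<xi> i}. q (\<xi> i) y * H y)" .
  have "particle_generator N \<xi> i (\<lambda>y. a * G y + b * H y) = (\<Sum>\<^sub>\<infinity>y\<in>\<Lambda> - {\<xi> i}. q (\<xi> i) y * (a * G y + b * H y))
    + killing (\<xi> i) / (real N - 1) * (\<Sum>j=1..N. a * G (\<xi> j) + b * H (\<xi> j))"
    by (rule particle_generator_eq[OF \<xi> i bound]) (simp add: G(2) H(2))
  then show ?thesis
    unfolding inf particle_generator_eq[where G = G, OF \<xi> i G] particle_generator_eq[where G = H, OF \<xi> i H] sum.distrib sum_distrib_left[symmetric]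
    by (simp only: ring_distribs mult.left_commute add_ac)
qed

lemma fv_generator_le:
  assumes N: "2 \<le> N" and \<xi>: "\<xi> \<in> {1..N} \<rightarrow>\<^sub>E \<Lambda>"
    and F: "\<And>i y. i \<in> {1..N} \<Longrightarrow> \<bar>F (\<xi>(i := y)) - F \<xi>\<bar> \<le> B"
  shows "\<bar>fv_generator \<Lambda> z q N F \<xi>\<bar> \<le> 3 * c * real N * B"
proof -
  have "\<bar>fv_generator \<Lambda> z q N F \<xi>\<bar> \<le> (\<Sum>i=1..N. 3 * c * B)"
    unfolding fv_generator_eq_sum
    using F by (intro order_trans[OF sum_abs sum_mono] particle_generator_le[OF N \<xi>]) auto
  then show ?thesis by (simp add: mult_ac)
qed

lemma particle_generator_test:
  assumes N: "2 \<le> N" and \<xi>: "\<xi> \<in> {1..N} \<rightarrow>\<^sub>E \<Lambda>" and i: "i \<in> {1..N}" and f: "test_function f"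
  shows "particle_generator N \<xi> i (\<lambda>y. f y - f (\<xi> i)) = generator f (\<xi> i) + killing (\<xi> i) * f (\<xi> i)
    + killing (\<xi> i) / (real N - 1) * (real N * empirical N f \<xi> - real N * f (\<xi> i))"
proof -
  have x: "\<xi> i \<in> \<Lambda>" using \<xi> i by auto
  have "(\<lambda>y. q (\<xi> i) y * (f y - f (\<xi> i))) summable_on insert z \<Lambda> - {\<xi> i}"
    using x q_summable q_nonneg test_diff_le[OF f] by (intro infsum_mult_bounded[where B = 2]) auto
  from infsum_split_finite[OF this, of "{z}"]
  have "generator f (\<xi> i) = q (\<xi> i) z * (f z - f (\<xi> i)) + (\<Sum>\<^sub>\<infinity>y\<in>insert z \<Lambda> - {\<xi> i} - {z}. q (\<xi> i) y * (f y - f (\<xi> i)))"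
    using x z_notin by (auto simp: generator_def)
  moreover have "insert z \<Lambda> - {\<xi> i} - {z} = \<Lambda> - {\<xi> i}" using z_notin by auto
  moreover have "q (\<xi> i) z * (f z - f (\<xi> i)) = - killing (\<xi> i) * f (\<xi> i)"
    using x z_notin test_outside[OF f] by (simp add: killing_def)
  ultimately have "(\<Sum>\<^sub>\<infinity>y\<in>\<Lambda> - {\<xi> i}. q (\<xi> i) y * (f y - f (\<xi> i))) = generator f (\<xi> i) + killing (\<xi> i) * f (\<xi> i)"
    by simp
  moreover have "(\<Sum>j=1..N. f (\<xi> j) - f (\<xi> i)) = real N * empirical N f \<xi> - real N * f (\<xi> i)"
    using N by (simp add: empirical_def sum_subtractf)
  moreover have "particle_generator N \<xi> i (\<lambda>y. f y - f (\<xi> i)) = (\<Sum>\<^sub>\<infinity>y\<in>\<Lambda> - {\<xi> i}. q (\<xi> i) y * (f y - f (\<xi> i)))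
    + killing (\<xi> i) / (real N - 1) * (\<Sum>j=1..N. f (\<xi> j) - f (\<xi> i))"
    by (rule particle_generator_eq[OF \<xi> i test_diff_le[OF f]]) simp
  ultimately show ?thesis by simp
qed

text \<open>The target of a killed particle is chosen among the other \<open>N - 1\<close> particles instead of all \<open>N\<close>, which
changes the factor \<open>1\<close> in front of \<open>m(k) m(f) - m(k f)\<close> into \<open>N / (N - 1)\<close>. This is the only
deviation from the mean field drift: the departure of killed particles is already counted by the
loss term in the generator of the absorbed chain.\<close>

lemma empirical_drift:
  assumes N: "2 \<le> N" and \<xi>: "\<xi> \<in> {1..N} \<rightarrow>\<^sub>E \<Lambda>" and f: "test_function f"
  shows "\<bar>(\<Sum>i=1..N. particle_generator N \<xi> i (\<lambda>y. f y - f (\<xi> i))) / real N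
    - (empirical N (generator f) \<xi> + empirical N killing \<xi> * empirical N f \<xi>)\<bar> \<le> 4 * c / real N"
proof -
  let ?kf = "empirical N (\<lambda>x. killing x * f x) \<xi>" and ?k = "empirical N killing \<xi>" and ?f = "empirical N f \<xi>"
  have N1: "0 < real N - 1" using N by simp
  define a where "a = real N * ?f / (real N - 1)"
  define b where "b = real N / (real N - 1)"
  have "(\<Sum>i=1..N. particle_generator N \<xi> i (\<lambda>y. f y - f (\<xi> i))) =
      (\<Sum>i=1..N. generator f (\<xi> i) + killing (\<xi> i) * f (\<xi> i) + (a * killing (\<xi> i) - b * (killing (\<xi> i) * f (\<xi> i))))"
    by (rule sum.cong) (auto simp: particle_generator_test[OF N \<xi> _ f] a_def b_def diff_divide_distrib algebra_simps)
  also have "\<dots> = real N * empirical N (generator f) \<xi> + real N * ?kf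
      + (a * (real N * ?k) - b * (real N * ?kf))"
    using N by (simp add: sum.distrib sum_subtractf sum_distrib_left[symmetric] empirical_def del: One_nat_def)
  also have "\<dots> = real N * (empirical N (generator f) \<xi> + ?kf + b * (?k * ?f - ?kf))"
    by (simp add: a_def b_def right_diff_distrib distrib_left mult_ac)
  finally have "(\<Sum>i=1..N. particle_generator N \<xi> i (\<lambda>y. f y - f (\<xi> i))) / real N
      = empirical N (generator f) \<xi> + ?kf + real N / (real N - 1) * (?k * ?f - ?kf)"
    using N by (simp add: b_def)
  also have "real N / (real N - 1) * (?k * ?f - ?kf) = (?k * ?f - ?kf) + (?k * ?f - ?kf) / (real N - 1)"
    using N1 by (simp add: field_simps)
  finally have eq: "(\<Sum>i=1..N. particle_generator N \<xi> i (\<lambda>y. f y - f (\<xi> i))) / real N - (empirical N (generator f) \<xi> + ?k * ?f)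
      = (?k * ?f - ?kf) / (real N - 1)" by simp
  have k: "\<bar>killing x\<bar> \<le> c" for x using killing_nonneg[of x] killing_le[of x] by simp
  have "\<bar>killing x * f x\<bar> \<le> c * 1" for x
    unfolding abs_mult using k test_abs_le[OF f] c_ge_1 by (intro mult_mono) auto
  then have kf: "\<bar>?kf\<bar> \<le> c" using N by (intro empirical_abs_le) auto
  have "\<bar>?k * ?f\<bar> \<le> c * 1"
    unfolding abs_mult using k test_abs_le[OF f] c_ge_1 N by (intro mult_mono empirical_abs_le) auto
  with kf have "\<bar>?k * ?f - ?kf\<bar> \<le> 2 * c" by linarith
  then have "\<bar>(?k * ?f - ?kf) / (real N - 1)\<bar> \<le> 2 * c / (real N - 1)"
    using N1 by (simp add: abs_divide divide_right_mono)
  also have "\<dots> \<le> 4 * c / real N"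
    using N c_ge_1 by (simp add: field_simps)
  finally show ?thesis unfolding eq .
qed

text \<open>For a move by \<open>\<delta>\<close>, the square \<open>(m(f) - b)\<^sup>2\<close> changes by \<open>2 (m(f) - b) \<delta> / N + \<delta>\<^sup>2 / N\<^sup>2\<close>. The first part
sums to the drift; the second one is the quadratic variation, \<open>N\<close> particles with squared
increments of order \<open>1 / N\<^sup>2\<close>.\<close>

lemma fv_generator_square:
  assumes N: "2 \<le> N" and \<xi>: "\<xi> \<in> {1..N} \<rightarrow>\<^sub>E \<Lambda>" and f: "test_function f" and b: "\<bar>b\<bar> \<le> 1"
  shows "\<bar>fv_generator \<Lambda> z q N (\<lambda>\<xi>. (empirical N f \<xi> - b)\<^sup>2) \<xi>
    - 2 * (empirical N f \<xi> - b) * (empirical N (generator f) \<xi> + empirical N killing \<xi> * empirical N f \<xi>)\<bar> \<le> 28 * c / real N"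
proof -
  let ?J = "\<lambda>i. particle_generator N \<xi> i (\<lambda>y. f y - f (\<xi> i))" and ?S = "\<lambda>i. particle_generator N \<xi> i (\<lambda>y. (f y - f (\<xi> i))\<^sup>2)"
  let ?D = "empirical N f \<xi> - b" and ?M = "empirical N (generator f) \<xi> + empirical N killing \<xi> * empirical N f \<xi>"
  have sq: "\<bar>(f y - f x)\<^sup>2\<bar> \<le> 4" for x y
    using power_mono[OF test_diff_le[OF f, of y x], of 2] by simp
  have "particle_generator N \<xi> i (\<lambda>y. (empirical N f (\<xi>(i := y)) - b)\<^sup>2 - ?D\<^sup>2)
      = 2 * ?D / real N * ?J i + 1 / (real N)\<^sup>2 * ?S i" if i: "i \<in> {1..N}" for i
  proof -
    have "(\<lambda>y. (empirical N f (\<xi>(i := y)) - b)\<^sup>2 - ?D\<^sup>2)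
        = (\<lambda>y. 2 * ?D / real N * (f y - f (\<xi> i)) + 1 / (real N)\<^sup>2 * (f y - f (\<xi> i))\<^sup>2)"
      unfolding empirical_move[OF i] using N by (auto simp: fun_eq_iff field_simps power2_eq_square)
    then show ?thesis
      using particle_generator_linear[OF N \<xi> i, of "\<lambda>y. f y - f (\<xi> i)" 2 "\<lambda>y. (f y - f (\<xi> i))\<^sup>2" 4
          "2 * ?D / real N" "1 / (real N)\<^sup>2"] test_diff_le[OF f] sq
      by simp
  qed
  then have "fv_generator \<Lambda> z q N (\<lambda>\<xi>. (empirical N f \<xi> - b)\<^sup>2) \<xi>
      = (\<Sum>i=1..N. 2 * ?D / real N * ?J i + 1 / (real N)\<^sup>2 * ?S i)"
    unfolding fv_generator_eq_sum by (intro sum.cong) auto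
  also have "\<dots> = 2 * ?D * (sum ?J {1..N} / real N) + sum ?S {1..N} / (real N)\<^sup>2"
    by (simp add: sum.distrib sum_distrib_left sum_divide_distrib)
  finally have eq: "fv_generator \<Lambda> z q N (\<lambda>\<xi>. (empirical N f \<xi> - b)\<^sup>2) \<xi> - 2 * ?D * ?M
      = 2 * ?D * (sum ?J {1..N} / real N - ?M) + sum ?S {1..N} / (real N)\<^sup>2"
    by (simp add: algebra_simps)
  have "\<bar>empirical N f \<xi>\<bar> \<le> 1" using N test_abs_le[OF f] by (intro empirical_abs_le) auto
  with b have "\<bar>?D\<bar> \<le> 2" by linarith
  then have "\<bar>2 * ?D\<bar> \<le> 4" by (simp only: abs_mult) simp
  then have 1: "\<bar>2 * ?D * (sum ?J {1..N} / real N - ?M)\<bar> \<le> 4 * (4 * c / real N)"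
    unfolding abs_mult[of "2 * ?D"] using empirical_drift[OF N \<xi> f] by (intro mult_mono) auto
  have "\<bar>sum ?S {1..N}\<bar> \<le> (\<Sum>i=1..N. 3 * c * 4)"
    using sq by (intro order_trans[OF sum_abs sum_mono] particle_generator_le[OF N \<xi>]) auto
  then have "\<bar>sum ?S {1..N} / (real N)\<^sup>2\<bar> \<le> 12 * c * real N / (real N)\<^sup>2"
    by (simp add: abs_divide divide_right_mono mult_ac)
  also have "\<dots> = 12 * c / real N"
    using N by (simp add: power2_eq_square)
  finally have 2: "\<bar>sum ?S {1..N} / (real N)\<^sup>2\<bar> \<le> 12 * c / real N" .
  show ?thesis
    unfolding eq using order_trans[OF abs_triangle_ineq add_mono[OF 1 2]] by simp
qed

end

section \<open>Growth of the mean square deviation\<close>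

text \<open>Here \<open>D\<close> is the deviation before the step, \<open>u\<close> the displacement of the conditioned mean with
velocity \<open>\<beta>\<close>, and \<open>M\<close> the drift of the empirical mean. Replacing \<open>u\<close> by \<open>h * \<beta>\<close> costs \<open>O(h\<^sup>2)\<close>.\<close>

lemma square_step_le:
  fixes D u h \<beta> M a b c :: real
  assumes D: "\<bar>D\<bar> \<le> 2" and u: "\<bar>u\<bar> \<le> a * h" and u\<beta>: "\<bar>u - h * \<beta>\<bar> \<le> b * h\<^sup>2" and M: "\<bar>M\<bar> \<le> c"
    and h: "0 \<le> h"
  shows "(D - u)\<^sup>2 + h * (2 * (D - u) * M) \<le> D\<^sup>2 + 2 * h * D * (M - \<beta>) + (4 * b + a\<^sup>2 + 2 * a * c) * h\<^sup>2"
proof -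
  have "(D - u)\<^sup>2 + h * (2 * (D - u) * M) - (D\<^sup>2 + 2 * h * D * (M - \<beta>)) = - 2 * (D * (u - h * \<beta>)) + u\<^sup>2 - 2 * (h * (u * M))"
    by (simp add: power2_eq_square algebra_simps)
  moreover have "\<bar>D * (u - h * \<beta>)\<bar> \<le> 2 * (b * h\<^sup>2)"
    unfolding abs_mult using D u\<beta> by (intro mult_mono) auto
  moreover have "u\<^sup>2 \<le> a\<^sup>2 * h\<^sup>2"
    using power_mono[OF u, of 2] by (simp add: power_mult_distrib)
  moreover have "\<bar>h * (u * M)\<bar> \<le> h * ((a * h) * c)"
    unfolding abs_mult using u M h by (intro mult_mono) auto
  ultimately have "(D - u)\<^sup>2 + h * (2 * (D - u) * M) - (D\<^sup>2 + 2 * h * D * (M - \<beta>))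
      \<le> 2 * (2 * (b * h\<^sup>2)) + a\<^sup>2 * h\<^sup>2 + 2 * (h * ((a * h) * c))"
    by linarith
  also have "\<dots> = (4 * b + a\<^sup>2 + 2 * a * c) * h\<^sup>2"
    by (simp add: power2_eq_square algebra_simps)
  finally show ?thesis by simp
qed

text \<open>Here \<open>G\<close> and \<open>E\<close> are the deviations for the normalised functions \<open>A f / (2 c)\<close> and \<open>k / c\<close>. Products of
deviations are split by \<open>2 a b \<le> a\<^sup>2 + b\<^sup>2\<close>; the coefficients on the right add up to 8, the constant in the
exponential rate \<open>8 c\<close>.\<close>

lemma cross_terms_le:
  fixes c D G E k p :: real
  assumes "0 \<le> k" "k \<le> c" "\<bar>p\<bar> \<le> 1"
  shows "2 * D * (2 * c * G + k * D + p * (c * E)) \<le> c * (5 * D\<^sup>2 + 2 * G\<^sup>2 + E\<^sup>2)"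
proof -
  have "2 * (D * G) \<le> D\<^sup>2 + G\<^sup>2" by (rule sum_squares_bound[of D G, unfolded mult.assoc])
  then have 1: "2 * c * (2 * (D * G)) \<le> 2 * c * (D\<^sup>2 + G\<^sup>2)"
    using assms by (intro mult_left_mono) auto
  have 2: "2 * (k * D\<^sup>2) \<le> 2 * (c * D\<^sup>2)"
    using assms by (intro mult_left_mono mult_right_mono) auto
  have "2 * (D * (p * E)) \<le> 2 * (\<bar>D\<bar> * (1 * \<bar>E\<bar>))"
    using assms abs_ge_self[of "D * (p * E)"] mult_mono[of "\<bar>p\<bar>" 1 "\<bar>E\<bar>" "\<bar>E\<bar>"]
      mult_left_mono[of "\<bar>p\<bar> * \<bar>E\<bar>" "1 * \<bar>E\<bar>" "\<bar>D\<bar>"] by (simp add: abs_mult)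
  also have "\<dots> \<le> D\<^sup>2 + E\<^sup>2"
    using sum_squares_bound[of "\<bar>D\<bar>" "\<bar>E\<bar>"] by (simp add: mult.assoc)
  finally have 3: "c * (2 * (D * (p * E))) \<le> c * (D\<^sup>2 + E\<^sup>2)"
    using assms by (intro mult_left_mono) auto
  show ?thesis
    using 1 2 3 by (simp add: power2_eq_square algebra_simps)
qed

locale fleming_viot_semigroup = absorbed_chain \<Lambda> z P q c
  for \<Lambda> :: "'a set" and z :: 'a and P q c +
  fixes N :: nat and R :: "real \<Rightarrow> (nat \<Rightarrow> 'a) \<Rightarrow> (nat \<Rightarrow> 'a) \<Rightarrow> real"
  assumes N: "2 \<le> N"
    and R_transition: "transition_function ({1..N} \<rightarrow>\<^sub>E \<Lambda>) R"
    and R_generator: "has_generator ({1..N} \<rightarrow>\<^sub>E \<Lambda>) R (fv_generator \<Lambda> z q N)"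
begin

abbreviation E :: "(nat \<Rightarrow> 'a) set" where "E \<equiv> {1..N} \<rightarrow>\<^sub>E \<Lambda>"

abbreviation KR :: "real \<Rightarrow> (nat \<Rightarrow> 'a) \<Rightarrow> (nat \<Rightarrow> 'a) pmf" where "KR \<equiv> kernel E R"

lemma KR_generator:
  assumes \<xi>: "\<xi> \<in> E" and F: "\<And>\<eta>. \<bar>F \<eta>\<bar> \<le> B"
  shows "((\<lambda>t. (mean (KR t \<xi>) F - F \<xi>) / t) \<longlongrightarrow> fv_generator \<Lambda> z q N F \<xi>) (at_right 0)"
proof (rule Lim_transform_eventually)
  have "bounded (F ` E)"
    using F by (auto simp: bounded_iff)
  then show "((\<lambda>t. ((\<Sum>\<^sub>\<infinity>\<eta>\<in>E. R t \<xi> \<eta> * F \<eta>) - F \<xi>) / t) \<longlongrightarrow> fv_generator \<Lambda> z q N F \<xi>) (at_right 0)"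
    using R_generator \<xi> unfolding has_generator_def by blast
  show "\<forall>\<^sub>F t in at_right 0. ((\<Sum>\<^sub>\<infinity>\<eta>\<in>E. R t \<xi> \<eta> * F \<eta>) - F \<xi>) / t = (mean (KR t \<xi>) F - F \<xi>) / t"
    using eventually_at_right_less[of 0]
  proof eventually_elim
    fix t :: real assume t: "0 < t"
    have "mean (KR t \<xi>) F = (\<Sum>\<^sub>\<infinity>\<eta>\<in>E. pmf (KR t \<xi>) \<eta> * F \<eta>)"
      by (rule mean_eq_infsum[OF set_kernel[OF R_transition]]) (use t \<xi> F in auto)
    also have "\<dots> = (\<Sum>\<^sub>\<infinity>\<eta>\<in>E. R t \<xi> \<eta> * F \<eta>)"
      by (rule infsum_cong) (use t in \<open>simp add: pmf_kernel[OF R_transition _ \<xi>] del: One_nat_def\<close>)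
    finally show "((\<Sum>\<^sub>\<infinity>\<eta>\<in>E. R t \<xi> \<eta> * F \<eta>) - F \<xi>) / t = (mean (KR t \<xi>) F - F \<xi>) / t" by simp
  qed
qed

text \<open>Applying the generator to the indicator of a single configuration gives the rate of leaving it,
which is bounded although it grows with \<open>N\<close>. This growth enters only the errors of second order in
the time step, which disappear in the limit of small steps.\<close>

lemma KR_semigroup: "bounded_rate_semigroup KR (3 * c * real N)"
proof
  fix \<xi>
  show "\<exists>r\<le>3 * c * real N. ((\<lambda>t. (1 - pmf (KR t \<xi>) \<xi>) / t) \<longlongrightarrow> r) (at_right 0)"
  proof (cases "\<xi> \<in> E")
    case True
    let ?F = "\<lambda>\<eta>. of_bool (\<eta> = \<xi>) :: real"
    have "((\<lambda>t. - ((mean (KR t \<xi>) ?F - ?F \<xi>) / t)) \<longlongrightarrow> - fv_generator \<Lambda> z q N ?F \<xi>) (at_right 0)"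
      by (intro tendsto_minus KR_generator[OF True, of _ 1]) auto
    moreover have "- ((mean (KR t \<xi>) ?F - ?F \<xi>) / t) = (1 - pmf (KR t \<xi>) \<xi>) / t" for t
      by (simp add: mean_of_bool_eq minus_divide_left)
    moreover have "\<bar>fv_generator \<Lambda> z q N ?F \<xi>\<bar> \<le> 3 * c * real N * 1"
      by (rule fv_generator_le[OF N True]) auto
    ultimately show ?thesis
      by (intro exI[of _ "- fv_generator \<Lambda> z q N ?F \<xi>"]) auto
  qed (use c_ge_1 in \<open>intro exI[of _ 0], auto simp: kernel_def\<close>)
qed (use kernel_0[OF R_transition] kernel_add[OF R_transition] in auto)

definition deviation :: "'a pmf \<Rightarrow> real \<Rightarrow> ('a \<Rightarrow> real) \<Rightarrow> (nat \<Rightarrow> 'a) \<Rightarrow> real" where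
  "deviation \<mu> s f \<xi> = empirical N f \<xi> - cond_mean \<mu> s f"

lemma empirical_test_le: "test_function f \<Longrightarrow> \<bar>empirical N f \<xi>\<bar> \<le> 1"
  using N test_abs_le[of f] by (intro empirical_abs_le) auto

lemma cond_test_le: "set_pmf \<mu> \<subseteq> \<Lambda> \<Longrightarrow> 0 \<le> s \<Longrightarrow> test_function f \<Longrightarrow> \<bar>cond_mean \<mu> s f\<bar> \<le> 1"
  by (rule cond_abs_le[OF _ _ test_le_indicator])

lemma deviation_le: "set_pmf \<mu> \<subseteq> \<Lambda> \<Longrightarrow> 0 \<le> s \<Longrightarrow> test_function f \<Longrightarrow> \<bar>deviation \<mu> s f \<xi>\<bar> \<le> 2"
  using empirical_test_le[of f \<xi>] cond_test_le[of \<mu> s f] by (simp add: deviation_def)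

text \<open>The constant in front of \<open>h\<^sup>2\<close> in the one-step inequality: \<open>b\<close> comes from the step of the conditioned
mean, \<open>a\<close> bounds its speed, and the last summand is the error of second order of the particle
semigroup for functions bounded by 4.\<close>

definition step_const :: real where
  "step_const = (let b = 11 * c\<^sup>2 + 8 * c ^ 3; a = 3 * c + b in
     4 * b + a\<^sup>2 + 2 * a * (3 * c) + 16 * (3 * c * real N)\<^sup>2)"

text \<open>The square of the deviation at time \<open>s + h\<close> is expanded around the configuration at time \<open>s\<close> with the
new value \<open>p'\<close> of the conditioned mean held fixed. The difference of the two drifts is
\<open>M - \<beta> = D(A f) + m(k) D(f) + \<phi>\<^sub>s(f) D(k)\<close>, linear in deviations, because
\<open>m(k) m(f) - \<phi>(k) \<phi>(f) = m(k) (m(f) - \<phi>(f)) + \<phi>(f) (m(k) - \<phi>(k))\<close>.\<close>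

lemma deviation_step_pointwise:
  assumes \<mu>: "set_pmf \<mu> \<subseteq> \<Lambda>" and s: "0 \<le> s" and h: "0 \<le> h" "h \<le> 1" and f: "test_function f" and \<xi>: "\<xi> \<in> E"
  shows "mean (KR h \<xi>) (\<lambda>\<eta>. (deviation \<mu> (s + h) f \<eta>)\<^sup>2) \<le> (deviation \<mu> s f \<xi>)\<^sup>2
    + h * c * (5 * (deviation \<mu> s f \<xi>)\<^sup>2 + 2 * (deviation \<mu> s (\<lambda>x. generator f x / (2 * c)) \<xi>)\<^sup>2 + (deviation \<mu> s (\<lambda>x. killing x / c) \<xi>)\<^sup>2)
    + 28 * c * h / real N + step_const * h\<^sup>2"
proof -
  define x where "x = empirical N f \<xi>"
  define p where "p = cond_mean \<mu> s f"
  define p' where "p' = cond_mean \<mu> (s + h) f"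
  define m where "m = empirical N killing \<xi>"
  define M where "M = empirical N (generator f) \<xi> + m * x"
  define \<beta> where "\<beta> = cond_mean \<mu> s (generator f) + cond_mean \<mu> s killing * p"
  define b where "b = 11 * c\<^sup>2 + 8 * c ^ 3"
  define D where "D = deviation \<mu> s f \<xi>"
  define G where "G = deviation \<mu> s (\<lambda>x. generator f x / (2 * c)) \<xi>"
  define H where "H = deviation \<mu> s (\<lambda>x. killing x / c) \<xi>"
  define L where "L = fv_generator \<Lambda> z q N (\<lambda>\<eta>. (empirical N f \<eta> - p')\<^sup>2) \<xi>"
  have sh: "0 \<le> s + h" using s h by simp
  have b: "0 \<le> b" using c_ge_1 by (simp add: b_def)
  have p': "\<bar>p'\<bar> \<le> 1" unfolding p'_def by (rule cond_test_le[OF \<mu> sh f])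
  have p: "\<bar>p\<bar> \<le> 1" unfolding p_def by (rule cond_test_le[OF \<mu> s f])
  have x: "\<bar>x\<bar> \<le> 1" unfolding x_def by (rule empirical_test_le[OF f])
  have m: "0 \<le> m" "\<bar>m\<bar> \<le> c"
    using N killing_nonneg killing_le empirical_abs_le[of N killing \<xi> c]
    by (simp_all add: m_def empirical_def sum_nonneg)
  have "\<bar>empirical N (generator f) \<xi>\<bar> \<le> 2 * c" using N generator_le[OF f] by (intro empirical_abs_le) auto
  moreover have "\<bar>m * x\<bar> \<le> c * 1" unfolding abs_mult using m x by (intro mult_mono) auto
  ultimately have M: "\<bar>M\<bar> \<le> 3 * c" unfolding M_def by linarith
  have "\<bar>cond_mean \<mu> s killing\<bar> \<le> c" by (rule cond_abs_le[OF \<mu> s killing_le_indicator])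
  then have "\<bar>cond_mean \<mu> s killing * p\<bar> \<le> c * 1" unfolding abs_mult using p by (intro mult_mono) auto
  moreover have "\<bar>cond_mean \<mu> s (generator f)\<bar> \<le> 2 * c" by (rule cond_abs_le[OF \<mu> s generator_le_indicator[OF f]])
  ultimately have \<beta>: "\<bar>\<beta>\<bar> \<le> 3 * c" unfolding \<beta>_def by linarith
  \<comment> \<open>\<open>p' - p\<close> is the displacement of the conditioned mean, \<open>\<beta>\<close> its velocity.\<close>
  have u\<beta>: "\<bar>(p' - p) - h * \<beta>\<bar> \<le> b * h\<^sup>2"
    using cond_mean_step[OF \<mu> s h f] by (simp add: p_def p'_def \<beta>_def b_def)
  have "\<bar>h * \<beta>\<bar> \<le> 3 * c * h" using \<beta> h by (simp add: abs_mult mult.commute mult_left_mono)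
  moreover have "b * h\<^sup>2 \<le> b * h"
    using b h by (intro mult_left_mono) (auto simp: power2_eq_square mult_left_le)
  ultimately have u: "\<bar>p' - p\<bar> \<le> (3 * c + b) * h"
    using u\<beta> by (simp add: distrib_right)
  have D: "D = x - p" "\<bar>D\<bar> \<le> 2"
    using deviation_le[OF \<mu> s f] by (simp_all add: D_def deviation_def x_def p_def)

  have F: "\<bar>(empirical N f \<eta> - p')\<^sup>2\<bar> \<le> 4" for \<eta>
  proof -
    have "\<bar>empirical N f \<eta> - p'\<bar> \<le> 2" using p' empirical_test_le[OF f, of \<eta>] by linarith
    from power_mono[OF this, of 2] show ?thesis by simp
  qed
  interpret particles: bounded_rate_semigroup KR "3 * c * real N" by (rule KR_semigroup)
  have "\<bar>mean (KR h \<xi>) (\<lambda>\<eta>. (empirical N f \<eta> - p')\<^sup>2) - (x - p')\<^sup>2 - h * L\<bar> \<le> 4 * (3 * c * real N)\<^sup>2 * h\<^sup>2 * 4"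
    unfolding x_def L_def by (rule particles.second_order[OF h(1) F KR_generator[OF \<xi> F]])
  moreover have "h * L \<le> h * (2 * (x - p') * M + 28 * c / real N)"
    using fv_generator_square[OF N \<xi> f p'] h by (intro mult_left_mono) (auto simp: L_def x_def M_def m_def)
  ultimately have "mean (KR h \<xi>) (\<lambda>\<eta>. (empirical N f \<eta> - p')\<^sup>2)
      \<le> ((x - p')\<^sup>2 + h * (2 * (x - p') * M)) + 28 * c * h / real N + 16 * (3 * c * real N)\<^sup>2 * h\<^sup>2"
    by (simp add: distrib_left algebra_simps)
  moreover have "(x - p')\<^sup>2 + h * (2 * (x - p') * M)
      \<le> D\<^sup>2 + 2 * h * D * (M - \<beta>) + (4 * b + (3 * c + b)\<^sup>2 + 2 * (3 * c + b) * (3 * c)) * h\<^sup>2"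
    using square_step_le[OF D(2) u u\<beta> M h(1)] by (simp add: D(1))
  moreover have GH: "2 * c * G = empirical N (generator f) \<xi> - cond_mean \<mu> s (generator f)" "c * H = m - cond_mean \<mu> s killing"
    using c_ge_1
    by (simp_all add: G_def H_def deviation_def cond_cmult empirical_def m_def sum_divide_distrib[symmetric] field_simps)
  then have "M - \<beta> = 2 * c * G + m * D + p * (c * H)"
    unfolding GH by (simp add: M_def \<beta>_def D(1) algebra_simps)
  then have "h * (2 * D * (M - \<beta>)) \<le> h * (c * (5 * D\<^sup>2 + 2 * G\<^sup>2 + H\<^sup>2))"
    using cross_terms_le[of m c p D G H] m p h by (intro mult_left_mono) auto
  ultimately have "mean (KR h \<xi>) (\<lambda>\<eta>. (empirical N f \<eta> - p')\<^sup>2)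
      \<le> D\<^sup>2 + h * c * (5 * D\<^sup>2 + 2 * G\<^sup>2 + H\<^sup>2) + 28 * c * h / real N
        + ((4 * b + (3 * c + b)\<^sup>2 + 2 * (3 * c + b) * (3 * c)) * h\<^sup>2 + 16 * (3 * c * real N)\<^sup>2 * h\<^sup>2)"
    by (simp add: mult_ac)
  also have "(4 * b + (3 * c + b)\<^sup>2 + 2 * (3 * c + b) * (3 * c)) * h\<^sup>2 + 16 * (3 * c * real N)\<^sup>2 * h\<^sup>2
      = step_const * h\<^sup>2"
    by (simp add: step_const_def Let_def b_def distrib_right)
  finally show ?thesis
    by (simp add: D_def G_def H_def deviation_def p'_def)
qed

text \<open>The bound \<open>v\<close> has to hold for all test functions at once, since the step for \<open>f\<close> also uses the
deviations of the generator of \<open>f\<close> and of the killing rate.\<close>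

lemma deviation_step:
  assumes \<mu>: "set_pmf \<mu> \<subseteq> \<Lambda>" and s: "0 \<le> s" and h: "0 \<le> h" "h \<le> 1" and f: "test_function f"
    and \<rho>: "set_pmf \<rho> \<subseteq> E"
    and v: "\<And>g. test_function g \<Longrightarrow> mean \<rho> (\<lambda>\<xi>. (deviation \<mu> s g \<xi>)\<^sup>2) \<le> v"
  shows "mean (bind_pmf \<rho> (KR h)) (\<lambda>\<xi>. (deviation \<mu> (s + h) f \<xi>)\<^sup>2)
    \<le> (1 + 8 * c * h) * v + (28 * c * h / real N + step_const * h\<^sup>2)"
proof -
  let ?g = "\<lambda>x. generator f x / (2 * c)" and ?k = "\<lambda>x. killing x / c"
  have sq: "\<bar>(deviation \<mu> s g \<xi>)\<^sup>2\<bar> \<le> 4" if "test_function g" for g \<xi>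
    using power_mono[OF deviation_le[OF \<mu> s that, of \<xi>], of 2] by simp
  have sq': "\<bar>(deviation \<mu> (s + h) f \<xi>)\<^sup>2\<bar> \<le> 4" for \<xi>
    using power_mono[OF deviation_le[OF \<mu> _ f, of "s + h" \<xi>], of 2] s h by simp
  have int: "integrable (measure_pmf \<rho>) (\<lambda>\<xi>. (deviation \<mu> s g \<xi>)\<^sup>2)" if "test_function g" for g
    by (rule integrable_pmf_bounded) (rule sq[OF that])
  note [simp] = int[OF f] int[OF test_generator[OF f]] int[OF test_killing]
  let ?w = "28 * c * h / real N + step_const * h\<^sup>2"
  let ?rhs = "\<lambda>\<xi>. (1 + 5 * c * h) * (deviation \<mu> s f \<xi>)\<^sup>2 + 2 * c * h * (deviation \<mu> s ?g \<xi>)\<^sup>2 + c * h * (deviation \<mu> s ?k \<xi>)\<^sup>2 + ?w"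
  have "mean (bind_pmf \<rho> (KR h)) (\<lambda>\<xi>. (deviation \<mu> (s + h) f \<xi>)\<^sup>2)
      = mean \<rho> (\<lambda>\<xi>. mean (KR h \<xi>) (\<lambda>\<eta>. (deviation \<mu> (s + h) f \<eta>)\<^sup>2))"
    by (rule mean_bind[OF sq'])
  also have "\<dots> \<le> mean \<rho> ?rhs"
  proof (rule integral_mono_AE)
    show "integrable (measure_pmf \<rho>) (\<lambda>\<xi>. mean (KR h \<xi>) (\<lambda>\<eta>. (deviation \<mu> (s + h) f \<eta>)\<^sup>2))"
      by (rule integrable_pmf_bounded[OF mean_abs_le[OF sq']])
    show "integrable (measure_pmf \<rho>) ?rhs" by simp
    show "AE \<xi> in \<rho>. mean (KR h \<xi>) (\<lambda>\<eta>. (deviation \<mu> (s + h) f \<eta>)\<^sup>2) \<le> ?rhs \<xi>"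
      unfolding AE_measure_pmf_iff
    proof
      fix \<xi> assume "\<xi> \<in> set_pmf \<rho>"
      then have "\<xi> \<in> E" using \<rho> by blast
      from deviation_step_pointwise[OF \<mu> s h f this]
      show "mean (KR h \<xi>) (\<lambda>\<eta>. (deviation \<mu> (s + h) f \<eta>)\<^sup>2) \<le> ?rhs \<xi>"
        by (simp add: algebra_simps)
    qed
  qed
  also have "\<dots> = (1 + 5 * c * h) * mean \<rho> (\<lambda>\<xi>. (deviation \<mu> s f \<xi>)\<^sup>2) + 2 * c * h * mean \<rho> (\<lambda>\<xi>. (deviation \<mu> s ?g \<xi>)\<^sup>2)
      + c * h * mean \<rho> (\<lambda>\<xi>. (deviation \<mu> s ?k \<xi>)\<^sup>2) + ?w"
    by simp
  also have "\<dots> \<le> (1 + 5 * c * h) * v + 2 * c * h * v + c * h * v + ?w"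
    using c_ge_1 h by (intro add_right_mono add_mono mult_left_mono v f test_generator test_killing) auto
  finally show ?thesis by (simp add: algebra_simps)
qed

text \<open>Discrete Gronwall: after \<open>n\<close> steps of length \<open>h = t / n\<close> the bound is
\<open>(1 + 8 c h)\<^sup>n (v + n w)\<close> with \<open>n w = 28 c t / N + O(1 / n)\<close>.\<close>

lemma mean_square_deviation_le:
  assumes \<mu>: "set_pmf \<mu> \<subseteq> \<Lambda>" and \<rho>: "set_pmf \<rho> \<subseteq> E" and t: "0 \<le> t" and f: "test_function f"
    and v: "\<And>g. test_function g \<Longrightarrow> mean \<rho> (\<lambda>\<xi>. (deviation \<mu> 0 g \<xi>)\<^sup>2) \<le> v"
  shows "mean (bind_pmf \<rho> (KR t)) (\<lambda>\<xi>. (deviation \<mu> t f \<xi>)\<^sup>2) \<le> exp (8 * c * t) * (v + 28 * c * t / real N)"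
proof -
  have v0: "0 \<le> v"
    by (rule order_trans[OF _ v[OF f]]) simp
  have bound: "mean (bind_pmf \<rho> (KR t)) (\<lambda>\<xi>. (deviation \<mu> t f \<xi>)\<^sup>2)
      \<le> exp (8 * c * t) * (v + 28 * c * t / real N + step_const * t\<^sup>2 / real n)" if n: "t \<le> real n" "0 < n" for n
  proof -
    define h where "h = t / real n"
    have h: "0 \<le> h" "h \<le> 1" "real n * h = t" using n t by (auto simp: h_def)
    define w where "w = 28 * c * h / real N + step_const * h\<^sup>2"
    have w: "0 \<le> w" using c_ge_1 h by (auto simp: w_def step_const_def Let_def)
    have a: "1 \<le> 1 + 8 * c * h" using c_ge_1 h by simp
    have "\<forall>g. test_function g \<longrightarrow> mean (bind_pmf \<rho> (KR (real k * h))) (\<lambda>\<xi>. (deviation \<mu> (real k * h) g \<xi>)\<^sup>2)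
        \<le> (1 + 8 * c * h) ^ k * (v + real k * w)" for k
    proof (induction k)
      case 0
      have "KR 0 = return_pmf" by (rule ext) (rule kernel_0[OF R_transition])
      then show ?case using v by (simp add: bind_return_pmf' del: One_nat_def)
    next
      case (Suc k)
      show ?case
      proof (intro allI impI)
        fix g assume g: "test_function g"
        have kh: "0 \<le> real k * h" using h by simp
        have S: "real (Suc k) * h = real k * h + h" by (simp add: distrib_right)
        have step: "bind_pmf \<rho> (KR (real (Suc k) * h)) = bind_pmf (bind_pmf \<rho> (KR (real k * h))) (KR h)"
          unfolding S bind_assoc_pmf using kh h by (intro bind_pmf_cong refl kernel_add[OF R_transition])
        have supp: "set_pmf (bind_pmf \<rho> (KR (real k * h))) \<subseteq> E"
          using \<rho> set_kernel[OF R_transition kh] by auto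
        have "mean (bind_pmf \<rho> (KR (real (Suc k) * h))) (\<lambda>\<xi>. (deviation \<mu> (real (Suc k) * h) g \<xi>)\<^sup>2)
            \<le> (1 + 8 * c * h) * ((1 + 8 * c * h) ^ k * (v + real k * w)) + w"
          unfolding step unfolding S w_def
          using Suc.IH by (intro deviation_step \<mu> kh h g supp) (simp add: w_def)
        also have "\<dots> \<le> (1 + 8 * c * h) ^ Suc k * (v + real k * w) + (1 + 8 * c * h) ^ Suc k * w"
          using mult_right_mono[OF one_le_power[OF a, of "Suc k"] w] by (simp add: mult.assoc)
        also have "\<dots> = (1 + 8 * c * h) ^ Suc k * (v + real (Suc k) * w)"
          by (simp add: algebra_simps)
        finally show "mean (bind_pmf \<rho> (KR (real (Suc k) * h))) (\<lambda>\<xi>. (deviation \<mu> (real (Suc k) * h) g \<xi>)\<^sup>2)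
            \<le> (1 + 8 * c * h) ^ Suc k * (v + real (Suc k) * w)" .
      qed
    qed
    from this[of n] f have "mean (bind_pmf \<rho> (KR t)) (\<lambda>\<xi>. (deviation \<mu> t f \<xi>)\<^sup>2) \<le> (1 + 8 * c * h) ^ n * (v + real n * w)"
      unfolding h(3) by blast
    also have "\<dots> \<le> exp (8 * c * t) * (v + real n * w)"
    proof (rule mult_right_mono)
      have "(1 + 8 * c * h) ^ n \<le> exp (8 * c * h) ^ n"
        using a by (intro power_mono exp_ge_add_one_self) auto
      also have "\<dots> = exp (8 * c * t)"
        by (simp add: exp_of_nat_mult[symmetric] h(3)[symmetric] mult_ac)
      finally show "(1 + 8 * c * h) ^ n \<le> exp (8 * c * t)" .
    qed (use v0 w in simp)
    also have "real n * w = 28 * c * t / real N + step_const * t\<^sup>2 / real n"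
      using n by (simp add: w_def h_def power2_eq_square field_simps)
    finally show ?thesis by (simp add: add.assoc)
  qed
  have "(\<lambda>n. exp (8 * c * t) * (v + 28 * c * t / real N + step_const * t\<^sup>2 / real n))
      \<longlonglongrightarrow> exp (8 * c * t) * (v + 28 * c * t / real N + 0)"
    by (intro tendsto_intros lim_const_over_n)
  then have "mean (bind_pmf \<rho> (KR t)) (\<lambda>\<xi>. (deviation \<mu> t f \<xi>)\<^sup>2) \<le> exp (8 * c * t) * (v + 28 * c * t / real N + 0)"
  proof (rule LIMSEQ_le_const)
    obtain m where "t \<le> real m" using real_arch_simple by blast
    then have "t \<le> real n \<and> 0 < n" if "max 1 m \<le> n" for n
      using that by (auto intro: order_trans[of t "real m"])
    then show "\<exists>m. \<forall>n\<ge>m. mean (bind_pmf \<rho> (KR t)) (\<lambda>\<xi>. (deviation \<mu> t f \<xi>)\<^sup>2)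
        \<le> exp (8 * c * t) * (v + 28 * c * t / real N + step_const * t\<^sup>2 / real n)"
      using bound by blast
  qed
  then show ?thesis by simp
qed

end

section \<open>Laws of the processes\<close>

text \<open>Random variables with values in a countable set are handled through the mass function of their
law, on which the estimates above are stated.\<close>

lemma law_of_countable_rv:
  fixes X :: "'w \<Rightarrow> 's"
  assumes M: "prob_space M" and X: "X \<in> measurable M (count_space S)" and S: "countable S"
  obtains p where "set_pmf p \<subseteq> S" "\<And>x. pmf p x = measure M {\<omega> \<in> space M. X \<omega> = x}"
    "\<And>F :: 's \<Rightarrow> real. prob_space.expectation M (\<lambda>\<omega>. F (X \<omega>)) = mean p F"
proof -
  interpret prob_space M by fact
  have XS: "X \<omega> \<in> S" if "\<omega> \<in> space M" for \<omega>
    using measurable_space[OF X that] by simp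
  have XU [measurable]: "X \<in> measurable M (count_space UNIV)"
  proof (rule measurableI)
    fix B :: "'s set"
    have "X -` B \<inter> space M = X -` (B \<inter> S) \<inter> space M" using XS by auto
    also have "\<dots> \<in> sets M" using X by (rule measurable_sets) auto
    finally show "X -` B \<inter> space M \<in> sets M" .
  qed simp
  define D where "D = distr M (count_space UNIV) X"
  have D: "measure D {x} = prob {\<omega> \<in> space M. X \<omega> = x}" for x
    unfolding D_def by (subst measure_distr) (auto intro!: arg_cong[where f = prob])
  have "AE \<omega> in M. \<forall>x\<in>S. measure D {x} = 0 \<longrightarrow> X \<omega> \<noteq> x"
  proof (subst AE_ball_countable[OF S], intro ballI)
    fix x
    show "AE \<omega> in M. measure D {x} = 0 \<longrightarrow> X \<omega> \<noteq> x"
    proof (cases "measure D {x} = 0")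
      case True
      then have "AE \<omega> in M. \<omega> \<notin> {\<omega> \<in> space M. X \<omega> = x}"
        by (intro AE_not_in) (auto simp: null_sets_def emeasure_eq_measure D)
      from this AE_space show ?thesis by eventually_elim auto
    qed simp
  qed
  then have "AE \<omega> in M. measure D {X \<omega>} \<noteq> 0"
    using AE_space by eventually_elim (use XS in auto)
  then have "AE x in D. measure D {x} \<noteq> 0"
    unfolding D_def by (subst AE_distr_iff) auto
  moreover have "prob_space D"
    unfolding D_def by (rule prob_space_distr) simp
  moreover have "sets D = UNIV" by (simp add: D_def)
  ultimately have mp: "measure_pmf (Abs_pmf D) = D"
    by (intro Abs_pmf_inverse) simp
  have pmf: "pmf (Abs_pmf D) x = prob {\<omega> \<in> space M. X \<omega> = x}" for x
    by (simp add: pmf.rep_eq mp D)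
  have "pmf (Abs_pmf D) x = 0" if "x \<notin> S" for x
  proof -
    have none: "{\<omega> \<in> space M. X \<omega> = x} = {}" using XS that by auto
    show ?thesis by (simp only: pmf none measure_empty)
  qed
  then have "set_pmf (Abs_pmf D) \<subseteq> S"
    by (metis set_pmf_iff subsetI)
  moreover have "expectation (\<lambda>\<omega>. F (X \<omega>)) = mean (Abs_pmf D) F" for F :: "'s \<Rightarrow> real"
    by (simp only: mp) (simp add: D_def integral_distr)
  ultimately show ?thesis using pmf that by blast
qed

lemma pmf_bind_Pair: "pmf (bind_pmf p (\<lambda>x. map_pmf (Pair x) (k x))) (a, b) = pmf p a * pmf (k a) b"
proof -
  have "pmf (map_pmf (Pair x) (k x)) (a, b) = of_bool (x = a) * pmf (k a) b" for x
  proof (cases "x = a")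
    case True
    then show ?thesis by (simp add: pmf_map_inj' inj_on_def)
  next
    case False
    then have "pmf (map_pmf (Pair x) (k x)) (a, b) = 0" by (intro pmf_map_outside) auto
    then show ?thesis using False by simp
  qed
  then show ?thesis by (simp add: pmf_bind mean_of_bool_eq)
qed

text \<open>The Markov property for the two times 0 and \<open>t\<close> identifies the joint law of \<open>X 0\<close> and \<open>X t\<close>; its
second marginal is the law at time \<open>t\<close>.\<close>

lemma jump_markov_process_law:
  fixes X :: "real \<Rightarrow> 'w \<Rightarrow> 's"
  assumes X: "jump_markov_process S P M X" and P: "transition_function S P" and S: "countable S"
    and p: "\<And>x. pmf p x = measure M {\<omega> \<in> space M. X 0 \<omega> = x}" and t: "0 \<le> t"
  shows "prob_space.expectation M (\<lambda>\<omega>. F (X t \<omega>)) = mean (bind_pmf p (kernel S P t)) F"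
proof -
  have M: "prob_space M" using X by (simp add: jump_markov_process_def)
  have meas: "X s \<in> measurable M (count_space S)" if "0 \<le> s" for s
    using X that by (simp add: jump_markov_process_def)
  have "(\<lambda>\<omega>. (X 0 \<omega>, X t \<omega>)) \<in> measurable M (count_space S \<Otimes>\<^sub>M count_space S)"
    using meas t by (intro measurable_Pair) auto
  then have pair: "(\<lambda>\<omega>. (X 0 \<omega>, X t \<omega>)) \<in> measurable M (count_space (S \<times> S))"
    using S by (simp add: pair_measure_countable)
  obtain J where J: "set_pmf J \<subseteq> S \<times> S"
    "\<And>ab. pmf J ab = measure M {\<omega> \<in> space M. (X 0 \<omega>, X t \<omega>) = ab}"
    "\<And>F :: 's \<times> 's \<Rightarrow> real. prob_space.expectation M (\<lambda>\<omega>. F (X 0 \<omega>, X t \<omega>)) = mean J F"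
    by (rule law_of_countable_rv[OF M pair countable_SIGMA[OF S S]], rule that)
  have "J = bind_pmf p (\<lambda>x. map_pmf (Pair x) (kernel S P t x))"
  proof (rule pmf_eqI)
    fix ab :: "'s \<times> 's"
    obtain a b where ab: "ab = (a, b)" by fastforce
    have "pmf J (a, b) = pmf p a * pmf (kernel S P t a) b"
    proof (cases "a \<in> S \<and> b \<in> S")
      case True
      define \<tau> where "\<tau> k = (if k = 0 then 0 else t)" for k :: nat
      define x where "x k = (if k = 0 then a else b)" for k :: nat
      have "0 \<le> \<tau> 0 \<and> (\<forall>k\<le>0. \<tau> k \<le> \<tau> (Suc k)) \<and> (\<forall>k\<le>Suc 0. x k \<in> S)"
        using t True by (auto simp: \<tau>_def x_def)
      then have "measure M {\<omega> \<in> space M. \<forall>k\<le>Suc 0. X (\<tau> k) \<omega> = x k}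
          = measure M {\<omega> \<in> space M. \<forall>k\<le>0. X (\<tau> k) \<omega> = x k} * P (\<tau> (Suc 0) - \<tau> 0) (x 0) (x (Suc 0))"
        using X unfolding jump_markov_process_def by blast
      moreover have "(\<forall>k\<le>Suc 0. X (\<tau> k) \<omega> = x k) \<longleftrightarrow> X 0 \<omega> = a \<and> X t \<omega> = b" for \<omega>
        by (auto simp: \<tau>_def x_def le_Suc_eq)
      ultimately show ?thesis
        using True t by (simp add: J(2) p pmf_kernel[OF P] \<tau>_def x_def)
    next
      case False
      have none: "{\<omega> \<in> space M. X 0 \<omega> = a} = {}" if "a \<notin> S"
        using measurable_space[OF meas[of 0]] that by auto
      have "pmf p a = 0" if "a \<notin> S" by (simp only: p none[OF that] measure_empty)
      then have "pmf p a = 0 \<or> a \<in> S" by blast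
      with False have "pmf p a * pmf (kernel S P t a) b = 0"
        by (auto simp: pmf_kernel[OF P t])
      moreover have "pmf J (a, b) = 0" using False J(1) by (auto simp: set_pmf_iff)
      ultimately show ?thesis by simp
    qed
    then show "pmf J ab = pmf (bind_pmf p (\<lambda>x. map_pmf (Pair x) (kernel S P t x))) ab"
      by (simp add: ab pmf_bind_Pair)
  qed
  then have "map_pmf snd J = bind_pmf p (kernel S P t)"
    by (simp add: map_bind_pmf pmf.map_comp comp_def)
  moreover have "mean (map_pmf snd J) F = prob_space.expectation M (\<lambda>\<omega>. F (X t \<omega>))"
    using J(3)[of "\<lambda>ab. F (snd ab)"] by simp
  ultimately show ?thesis by simp
qed

text \<open>After centring, the products of distinct variables have mean 0 by independence, and the \<open>N\<close> squares
are at most 4.\<close>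

lemma iid_mean_square:
  fixes g :: "'a \<Rightarrow> real"
  assumes M: "prob_space M" and N: "1 \<le> N" and g: "\<And>x. \<bar>g x\<bar> \<le> 1"
    and indep: "prob_space.indep_vars M (\<lambda>_. count_space \<Lambda>) Y {1..N}"
    and a: "\<And>i. i \<in> {1..N} \<Longrightarrow> prob_space.expectation M (\<lambda>\<omega>. g (Y i \<omega>)) = a"
  shows "prob_space.expectation M (\<lambda>\<omega>. ((\<Sum>i=1..N. g (Y i \<omega>)) / real N - a)\<^sup>2) \<le> 4 / real N"
proof -
  interpret prob_space M by fact
  define Z where "Z i \<omega> = g (Y i \<omega>) - a" for i \<omega>
  have indepZ: "indep_vars (\<lambda>_. borel) Z {1..N}"
    unfolding Z_def by (rule indep_vars_compose2[OF indep]) simp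
  have meas: "Z i \<in> borel_measurable M" if "i \<in> {1..N}" for i
    using indepZ that by (auto simp: indep_vars_def)
  have gint: "integrable M (\<lambda>\<omega>. g (Y i \<omega>))" if "i \<in> {1..N}" for i
  proof (rule integrable_const_bound[where B = 1])
    have "(\<lambda>\<omega>. Z i \<omega> + a) \<in> borel_measurable M" using meas[OF that] by simp
    then show "(\<lambda>\<omega>. g (Y i \<omega>)) \<in> borel_measurable M" by (simp add: Z_def)
  qed (use g in auto)
  have "\<bar>a\<bar> \<le> 1"
  proof -
    have "\<bar>a\<bar> \<le> expectation (\<lambda>\<omega>. \<bar>g (Y 1 \<omega>)\<bar>)" using a[of 1] N by auto
    also have "\<dots> \<le> expectation (\<lambda>\<omega>. 1)"
      using gint[of 1] N g by (intro integral_mono) auto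
    finally show ?thesis by (simp add: prob_space)
  qed
  then have Z: "\<bar>Z i \<omega>\<bar> \<le> 2" for i \<omega>
    using g[of "Y i \<omega>"] by (simp add: Z_def)
  have ZZ: "\<bar>Z i \<omega> * Z j \<omega>\<bar> \<le> 4" for i j \<omega>
    using mult_mono[OF Z[of i \<omega>] Z[of j \<omega>]] by (simp add: abs_mult)
  have intZ: "integrable M (Z i)" if "i \<in> {1..N}" for i
    by (rule integrable_const_bound[where B = 2]) (use Z meas that in auto)
  have intZZ: "integrable M (\<lambda>\<omega>. Z i \<omega> * Z j \<omega>)" if "i \<in> {1..N}" "j \<in> {1..N}" for i j
    by (rule integrable_const_bound[where B = 4]) (use ZZ meas that in auto)
  have EZ: "expectation (Z i) = 0" if "i \<in> {1..N}" for i
    using a[OF that] gint[OF that] by (simp add: Z_def[abs_def] prob_space)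
  have E: "expectation (\<lambda>\<omega>. Z i \<omega> * Z j \<omega>) \<le> (if i = j then 4 else 0)"
    if ij: "i \<in> {1..N}" "j \<in> {1..N}" for i j
  proof (cases "i = j")
    case True
    have "expectation (\<lambda>\<omega>. Z i \<omega> * Z j \<omega>) \<le> expectation (\<lambda>\<omega>. 4)"
      using ZZ[of i _ j] by (intro integral_mono intZZ ij) (auto simp: abs_le_iff)
    then show ?thesis using True by (simp add: prob_space)
  next
    case False
    have "expectation (\<lambda>\<omega>. \<Prod>k\<in>{i, j}. Z k \<omega>) = (\<Prod>k\<in>{i, j}. expectation (Z k))"
      by (rule indep_vars_lebesgue_integral)
         (use ij intZ in \<open>auto intro: indep_vars_subset[OF indepZ]\<close>)
    then show ?thesis using False EZ ij by simp
  qed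
  have "((\<Sum>i=1..N. g (Y i \<omega>)) / real N - a)\<^sup>2 = (\<Sum>i=1..N. \<Sum>j=1..N. Z i \<omega> * Z j \<omega>) / (real N)\<^sup>2" for \<omega>
  proof -
    have "(\<Sum>i=1..N. g (Y i \<omega>)) / real N - a = (\<Sum>i=1..N. Z i \<omega>) / real N"
      using N by (simp add: Z_def sum_subtractf field_simps)
    then show ?thesis by (simp add: power_divide power2_eq_square sum_product)
  qed
  then have "expectation (\<lambda>\<omega>. ((\<Sum>i=1..N. g (Y i \<omega>)) / real N - a)\<^sup>2)
      = (\<Sum>i=1..N. \<Sum>j=1..N. expectation (\<lambda>\<omega>. Z i \<omega> * Z j \<omega>)) / (real N)\<^sup>2"
    using intZZ
    by (simp add: Bochner_Integration.integral_sum Bochner_Integration.integrable_sum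
        del: One_nat_def atLeastAtMost_iff)
  also have "\<dots> \<le> (\<Sum>i=1..N. \<Sum>j=1..N. if i = j then 4 else 0) / (real N)\<^sup>2"
    by (intro divide_right_mono sum_mono E) auto
  also have "\<dots> = 4 / real N"
    by (simp add: power2_eq_square)
  finally show ?thesis .
qed

lemma (in absorbed_chain) conditioned_law_eq_cond:
  assumes \<mu>: "set_pmf p \<subseteq> \<Lambda>" "\<And>y. y \<in> \<Lambda> \<Longrightarrow> pmf p y = measure \<mu> {y}" and t: "0 \<le> t" and x: "x \<in> \<Lambda>"
  shows "conditioned_law \<Lambda> z P \<mu> t x = cond_mean p t (indicator {x})"
proof -
  have law: "pmf (law p t) w = (\<Sum>\<^sub>\<infinity>y\<in>\<Lambda>. measure \<mu> {y} * P t y w)" if "w \<in> insert z \<Lambda>" for w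
  proof -
    have "pmf (law p t) w = (\<Sum>\<^sub>\<infinity>y\<in>\<Lambda>. pmf p y * pmf (K t y) w)"
      unfolding law_def pmf_bind by (rule mean_eq_infsum[where B = 1]) (use \<mu> in \<open>auto simp: pmf_le_1\<close>)
    also have "\<dots> = (\<Sum>\<^sub>\<infinity>y\<in>\<Lambda>. measure \<mu> {y} * P t y w)"
      by (rule infsum_cong) (use \<mu> t that in \<open>simp add: pmf_kernel[OF transition]\<close>)
    finally show ?thesis .
  qed
  have "set_pmf (law p t) \<subseteq> insert z \<Lambda>"
    using \<mu>(1) set_kernel[OF transition t] by (auto simp: law_def)
  then have "mean (law p t) (indicator \<Lambda>) = mean (law p t) (\<lambda>y. of_bool (y \<noteq> z))"
    by (intro integral_cong_AE) (use z_notin in \<open>auto simp: AE_measure_pmf_iff indicator_def\<close>)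
  then have "mean (law p t) (indicator \<Lambda>) = 1 - pmf (law p t) z"
    by (simp only: mean_of_bool_neq)
  moreover have "mean (law p t) (indicator {x}) = pmf (law p t) x"
    by (simp add: pmf.rep_eq)
  ultimately show ?thesis
    using law x by (simp add: conditioned_law_def cond_mean_def)
qed

lemma (in absorbed_chain) cond_0:
  assumes "set_pmf p \<subseteq> \<Lambda>"
  shows "cond_mean p 0 f = mean p f"
proof -
  have "K 0 = return_pmf" by (rule ext) (rule K_0)
  then have "law p 0 = p" by (simp add: law_def bind_return_pmf')
  moreover have "measure p \<Lambda> = 1"
    using assms by (subst measure_pmf.prob_eq_1) (auto simp: AE_measure_pmf_iff)
  ultimately show ?thesis by (simp add: cond_mean_def)
qed

lemma infsum_le_of_SUP_ennreal:
  fixes q :: "'a \<Rightarrow> 'b \<Rightarrow> real"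
  assumes "(SUP x\<in>A. \<Sum>\<^sub>\<infinity>y\<in>B x. ennreal (q x y)) < \<infinity>"
    and "\<And>x. x \<in> A \<Longrightarrow> q x summable_on B x" "\<And>x y. x \<in> A \<Longrightarrow> y \<in> B x \<Longrightarrow> 0 \<le> q x y"
  obtains c :: real where "1 \<le> c" "\<And>x. x \<in> A \<Longrightarrow> (\<Sum>\<^sub>\<infinity>y\<in>B x. q x y) \<le> c"
proof
  let ?s = "SUP x\<in>A. \<Sum>\<^sub>\<infinity>y\<in>B x. ennreal (q x y)"
  show "1 \<le> max 1 (enn2real ?s)" by simp
  fix x assume x: "x \<in> A"
  have "(\<Sum>\<^sub>\<infinity>y\<in>B x. q x y) \<le> enn2real ?s"
  proof (rule infsum_le_finite_sums)
    fix F assume F: "finite F" "F \<subseteq> B x"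
    have "ennreal (sum (q x) F) = (\<Sum>y\<in>F. ennreal (q x y))"
      using F assms(3)[OF x] by (subst sum_ennreal) auto
    also have "\<dots> \<le> (\<Sum>\<^sub>\<infinity>y\<in>B x. ennreal (q x y))"
      using F by (subst nonneg_infsum_complete) (auto intro: SUP_upper)
    also have "\<dots> \<le> ?s" using x by (rule SUP_upper)
    finally have "ennreal (sum (q x) F) \<le> ennreal (enn2real ?s)"
      using assms(1) by simp
    then show "sum (q x) F \<le> enn2real ?s"
      by (simp add: ennreal_le_iff)
  qed (use assms(2) x in auto)
  then show "(\<Sum>\<^sub>\<infinity>y\<in>B x. q x y) \<le> max 1 (enn2real ?s)" by simp
qed

section \<open>Convergence to the conditioned law\<close>

theorem theorem1p2:
  fixes \<Lambda> :: "'a set" and z :: 'a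
    and q :: "'a \<Rightarrow> 'a \<Rightarrow> real" and P :: "real \<Rightarrow> 'a \<Rightarrow> 'a \<Rightarrow> real"
    and \<P> :: "'a \<Rightarrow> 'w measure" and Z :: "real \<Rightarrow> 'w \<Rightarrow> 'a"
    and \<mu> :: "'a measure"
    and M :: "nat \<Rightarrow> 'v measure" and \<xi> :: "nat \<Rightarrow> real \<Rightarrow> 'v \<Rightarrow> nat \<Rightarrow> 'a"
  assumes "countable \<Lambda>" and "z \<notin> \<Lambda>"
    and "transition_function (insert z \<Lambda>) P"
    and "has_rates (insert z \<Lambda>) P q"
    and "\<And>x. x \<in> insert z \<Lambda> \<Longrightarrow> jump_markov_process (insert z \<Lambda>) P (\<P> x) Z"
    and "\<And>x. x \<in> insert z \<Lambda> \<Longrightarrow> AE \<omega> in \<P> x. Z 0 \<omega> = x"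
    and "\<And>x. x \<in> \<Lambda> \<Longrightarrow> q z x = 0"
    and "(SUP x\<in>\<Lambda>. \<Sum>\<^sub>\<infinity>y\<in>insert z \<Lambda> - {x}. ennreal (q x y)) < \<infinity>"
    and "\<And>t x y. t > 0 \<Longrightarrow> x \<in> \<Lambda> \<Longrightarrow> y \<in> \<Lambda> \<Longrightarrow> P t x y > 0"
    and "\<And>x. x \<in> insert z \<Lambda> \<Longrightarrow> AE \<omega> in \<P> x. absorption_time z Z \<omega> < \<infinity>"
    and "prob_space \<mu>" and "sets \<mu> = sets (count_space \<Lambda>)"
    and "\<And>N. N \<ge> 2 \<Longrightarrow> fleming_viot \<Lambda> z q N (M N) (\<xi> N)"
    and "\<And>N. N \<ge> 2 \<Longrightarrow>
           prob_space.indep_vars (M N) (\<lambda>_. count_space \<Lambda>) (\<lambda>i \<omega>. \<xi> N 0 \<omega> i) {1..N}"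
    and "\<And>N i. N \<ge> 2 \<Longrightarrow> i \<in> {1..N} \<Longrightarrow>
           distr (M N) (count_space \<Lambda>) (\<lambda>\<omega>. \<xi> N 0 \<omega> i) = \<mu>"
  shows "\<forall>t>0. \<forall>x\<in>\<Lambda>.
           (\<lambda>N. prob_space.expectation (M N)
                  (\<lambda>\<omega>. (occupation N (\<xi> N t \<omega>) x / real N - conditioned_law \<Lambda> z P \<mu> t x)\<^sup>2))
           \<longlonglongrightarrow> 0"
proof (intro allI impI ballI)
  fix t :: real and x assume t: "0 < t" and x: "x \<in> \<Lambda>"
  obtain c where c: "1 \<le> c" "\<And>x. x \<in> \<Lambda> \<Longrightarrow> (\<Sum>\<^sub>\<infinity>y\<in>insert z \<Lambda> - {x}. q x y) \<le> c"
    using infsum_le_of_SUP_ennreal[OF assms(8)] rates_nonneg[OF assms(3,4)] assms(4)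
    by (auto simp: has_rates_def)
  interpret absorbed_chain \<Lambda> z P q c
    by unfold_locales (use assms c in auto)
  have space: "space \<mu> = \<Lambda>" using sets_eq_imp_space_eq[OF assms(12)] by simp
  have id: "(\<lambda>y. y) \<in> measurable \<mu> (count_space \<Lambda>)"
    using assms(12) by (simp add: measurable_ident_sets)
  obtain p where p: "set_pmf p \<subseteq> \<Lambda>" "\<And>y. pmf p y = measure \<mu> {w \<in> space \<mu>. w = y}"
    "\<And>F :: 'a \<Rightarrow> real. prob_space.expectation \<mu> F = mean p F"
    by (rule law_of_countable_rv[OF assms(11) id assms(1)], rule that)
  have p_eq: "pmf p y = measure \<mu> {y}" if "y \<in> \<Lambda>" for y
  proof -
    have "{w \<in> space \<mu>. w = y} = {y}" using that space by auto
    then show ?thesis by (simp add: p(2))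
  qed
  let ?f = "indicator {x} :: 'a \<Rightarrow> real"
  have f: "test_function ?f" using x by (intro test_indicator) simp
  let ?err = "\<lambda>N. prob_space.expectation (M N)
      (\<lambda>\<omega>. (occupation N (\<xi> N t \<omega>) x / real N - conditioned_law \<Lambda> z P \<mu> t x)\<^sup>2)"
  have bound: "?err N \<le> exp (8 * c * t) * (4 / real N + 28 * c * t / real N)" if N: "2 \<le> N" for N
  proof -
    obtain R where R: "transition_function ({1..N} \<rightarrow>\<^sub>E \<Lambda>) R"
      "has_generator ({1..N} \<rightarrow>\<^sub>E \<Lambda>) R (fv_generator \<Lambda> z q N)"
      "jump_markov_process ({1..N} \<rightarrow>\<^sub>E \<Lambda>) R (M N) (\<xi> N)"
      using assms(13)[OF N] unfolding fleming_viot_def by blast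
    interpret fleming_viot_semigroup \<Lambda> z P q c N R
      by unfold_locales (use N R in auto)
    have MN: "prob_space (M N)" and \<xi>0: "\<xi> N 0 \<in> measurable (M N) (count_space E)"
      using R(3) by (auto simp: jump_markov_process_def)
    have E: "countable E" using assms(1) by (intro countable_PiE) auto
    obtain \<rho> where \<rho>: "set_pmf \<rho> \<subseteq> E" "\<And>y. pmf \<rho> y = measure (M N) {\<omega> \<in> space (M N). \<xi> N 0 \<omega> = y}"
      "\<And>F :: (nat \<Rightarrow> 'a) \<Rightarrow> real. prob_space.expectation (M N) (\<lambda>\<omega>. F (\<xi> N 0 \<omega>)) = mean \<rho> F"
      by (rule law_of_countable_rv[OF MN \<xi>0 E], rule that)
    have init: "mean \<rho> (\<lambda>\<eta>. (deviation p 0 g \<eta>)\<^sup>2) \<le> 4 / real N" if g: "test_function g" for g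
    proof -
      have "prob_space.expectation (M N) (\<lambda>\<omega>. g (\<xi> N 0 \<omega> i)) = mean p g" if i: "i \<in> {1..N}" for i
      proof -
        have "(\<lambda>\<omega>. \<xi> N 0 \<omega> i) \<in> measurable (M N) (count_space \<Lambda>)"
          using assms(14)[OF N] i MN by (auto simp: prob_space.indep_vars_def)
        then have "prob_space.expectation (M N) (\<lambda>\<omega>. g (\<xi> N 0 \<omega> i)) = prob_space.expectation \<mu> g"
          by (subst assms(15)[OF N i, symmetric], subst integral_distr) auto
        then show ?thesis by (simp only: p(3))
      qed
      from iid_mean_square[OF MN _ test_abs_le[OF g] assms(14)[OF N] this] N
      show ?thesis
        by (simp add: \<rho>(3)[symmetric] deviation_def empirical_def cond_0[OF p(1)])
    qed
    have "?err N = prob_space.expectation (M N) (\<lambda>\<omega>. (deviation p t ?f (\<xi> N t \<omega>))\<^sup>2)"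
    proof -
      have "occupation N \<eta> x = (\<Sum>i=1..N. ?f (\<eta> i))" for \<eta>
        unfolding occupation_def by (rule sum.cong) (auto simp: indicator_def)
      then show ?thesis
        using t x by (simp add: deviation_def empirical_def conditioned_law_eq_cond[OF p(1) p_eq])
    qed
    also have "\<dots> = mean (bind_pmf \<rho> (KR t)) (\<lambda>\<eta>. (deviation p t ?f \<eta>)\<^sup>2)"
      using t by (intro jump_markov_process_law[OF R(3,1) E \<rho>(2)]) simp
    also have "\<dots> \<le> exp (8 * c * t) * (4 / real N + 28 * c * t / real N)"
      using t by (intro mean_square_deviation_le[OF p(1) \<rho>(1) _ f init]) auto
    finally show ?thesis .
  qed
  have "(\<lambda>N. exp (8 * c * t) * (4 / real N + 28 * c * t / real N)) \<longlonglongrightarrow> exp (8 * c * t) * (0 + 0)"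
    by (intro tendsto_intros lim_const_over_n)
  then have lim: "(\<lambda>N. exp (8 * c * t) * (4 / real N + 28 * c * t / real N)) \<longlonglongrightarrow> 0" by simp
  show "?err \<longlonglongrightarrow> 0"
  proof (rule tendsto_sandwich[OF _ _ tendsto_const lim])
    show "\<forall>\<^sub>F N in sequentially. 0 \<le> ?err N"
      by (intro always_eventually allI Bochner_Integration.integral_nonneg) simp
    show "\<forall>\<^sub>F N in sequentially. ?err N \<le> exp (8 * c * t) * (4 / real N + 28 * c * t / real N)"
      using eventually_ge_at_top[of 2] by eventually_elim (rule bound)
  qed
qed

end
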